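(* Let $n\in\mathbb{N}$ and let $T$ be the monoid with identity element $e$ generated by $\sigma_i,\theta_i$, $i=1,\dots,n-1$, subject to the relations (for all $i,j\in\{1,\dots,n-1\}$): (1) $\sigma_i^2=e$; $\sigma_i\sigma_j=\sigma_j\sigma_i$ if $|i-j|>1$; $\sigma_i\sigma_j\sigma_i=\sigma_j\sigma_i\sigma_j$ if $|i-j|=1$; (2) $\theta_i^2=\theta_i$; $\theta_i\theta_j=\theta_j\theta_i$ if $|i-j|>1$; $\theta_i\theta_j\theta_i=\theta_i$ if $|i-j|=1$; (3) $\theta_i\sigma_i=\sigma_i\theta_i=\theta_i$; $\theta_i\sigma_j=\sigma_j\theta_i$ if $|i-j|>1$; (4) $\sigma_i\theta_j\theta_i=\sigma_j\theta_i$ and $\theta_i\theta_j\sigma_i=\theta_i\sigma_j$ if $|i-j|=1$. Then the map $\sigma_i\mapsto s_i$, $\theta_i\mapsto\pi_i$, $i=1,\dots,n-1$, extends to an isomorphism of monoids $\varphi:T\to\mathfrak{B}_n$, where $\mathfrak{B}_n$ is the Brauer monoid.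
   Context: Let $M=\{1,\dots,n\}$ and let $M'=\{1',\dots,n'\}$ be a disjoint copy of $M$. The partition monoid $\mathfrak{C}_n$ is the set of all partitions (into nonempty blocks) of $M\cup M'$ with the following product. For $\alpha,\beta\in\mathfrak{C}_n$, identify each element $i'$ of $\alpha$ with the element $i$ of $\beta$ (a middle row $M''$), take the smallest equivalence relation on (left row $M$ of $\alpha$) $\cup M''\cup$ (right row $M'$ of $\beta$) containing both block relations, and restrict it to $M\cup M'$; the resulting partition is $\alpha\beta$ (components lying entirely in the middle row are discarded). The identity is the partition with blocks $\{j,j'\}$, $j\in M$. The Brauer monoid $\mathfrak{B}_n$ is the submonoid of $\mathfrak{C}_n$ of all partitions all of whose blocks have exactly $2$ elements (each block is either a line, meeting both $M$ and $M'$, or a bracket, contained in $M$ or in $M'$). For $i=1,\dots,n-1$: $s_i\in\mathfrak{B}_n$ has blocks $\{i,(i+1)'\}$, $\{i+1,i'\}$ and $\{j,j'\}$ for $j\ne i,i+1$ (the elementary transposition $(i,i+1)$); $\pi_i\in\mathfrak{B}_n$ has blocks $\{i,i+1\}$, $\{i',(i+1)'\}$ and $\{j,j'\}$ for $j\neq i,i+1$. *)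

theory Defs
  imports "HOL-Algebra.Group" "HOL-Library.Disjoint_Sets"
begin

section \<open>Monoid presentations\<close>

text \<open>The congruence on the free monoid \<^term>\<open>lists X\<close> generated by a set \<open>R\<close> of pairs of words;
  pairs of \<open>R\<close> that are not words over \<open>X\<close> are ignored.\<close>

inductive_set pres_cong :: "'g set \<Rightarrow> ('g list \<times> 'g list) set \<Rightarrow> ('g list \<times> 'g list) set"
  for X :: "'g set" and R :: "('g list \<times> 'g list) set" where
  rel: "(u, v) \<in> R \<Longrightarrow> u \<in> lists X \<Longrightarrow> v \<in> lists X \<Longrightarrow> (u, v) \<in> pres_cong X R"
| refl: "u \<in> lists X \<Longrightarrow> (u, u) \<in> pres_cong X R"
| sym: "(u, v) \<in> pres_cong X R \<Longrightarrow> (v, u) \<in> pres_cong X R"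
| trans: "(u, v) \<in> pres_cong X R \<Longrightarrow> (v, w) \<in> pres_cong X R \<Longrightarrow> (u, w) \<in> pres_cong X R"
| append: "(u, v) \<in> pres_cong X R \<Longrightarrow> (u', v') \<in> pres_cong X R
    \<Longrightarrow> (u @ u', v @ v') \<in> pres_cong X R"

definition pres_class :: "'g set \<Rightarrow> ('g list \<times> 'g list) set \<Rightarrow> 'g list \<Rightarrow> 'g list set" where
  "pres_class X R w = pres_cong X R `` {w}"

definition presented_monoid :: "'g set \<Rightarrow> ('g list \<times> 'g list) set \<Rightarrow> 'g list set monoid" where
  "presented_monoid X R =
    \<lparr>carrier = lists X // pres_cong X R,
     mult = (\<lambda>A B. \<Union>u\<in>A. \<Union>v\<in>B. pres_class X R (u @ v)),
     one = pres_class X R []\<rparr>"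

lemma equiv_pres_cong: "equiv (lists X) (pres_cong X R)"
proof (rule equivI)
  have "u \<in> lists X \<and> v \<in> lists X" if "(u, v) \<in> pres_cong X R" for u v
    using that by induction auto
  then show "pres_cong X R \<subseteq> lists X \<times> lists X" by auto
  show "refl_on (lists X) (pres_cong X R)"
    by (rule refl_onI) (rule pres_cong.refl)
  show "Relation.sym (pres_cong X R)"
    by (rule symI) (rule pres_cong.sym)
  show "Relation.trans (pres_cong X R)"
    by (rule transI) (rule pres_cong.trans)
qed

lemma pres_class_append:
  assumes "u' \<in> pres_class X R u" "v' \<in> pres_class X R v"
  shows "pres_class X R (u' @ v') = pres_class X R (u @ v)"
proof -
  have "(u @ v, u' @ v') \<in> pres_cong X R"
    using assms by (intro pres_cong.append) (simp_all only: pres_class_def Image_singleton_iff)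
  from equiv_class_eq[OF equiv_pres_cong this] show ?thesis
    unfolding pres_class_def by (rule HOL.sym)
qed

lemma presented_monoid_mult_class:
  assumes "u \<in> lists X" "v \<in> lists X"
  shows "pres_class X R u \<otimes>\<^bsub>presented_monoid X R\<^esub> pres_class X R v = pres_class X R (u @ v)"
proof -
  have "u \<in> pres_class X R u" "v \<in> pres_class X R v"
    using assms by (simp_all only: pres_class_def Image_singleton_iff pres_cong.refl)
  then have "(\<Union>u'\<in>pres_class X R u. \<Union>v'\<in>pres_class X R v. pres_class X R (u' @ v'))
      = pres_class X R (u @ v)"
    using pres_class_append[of _ X R u _ v] by blast
  then show ?thesis
    by (simp add: presented_monoid_def)
qed

lemma monoid_presented_monoid: "monoid (presented_monoid X R)"
proof -
  have car: "carrier (presented_monoid X R) = pres_class X R ` lists X"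
    unfolding presented_monoid_def pres_class_def quotient_def monoid.simps partial_object.simps by blast
  have one: "\<one>\<^bsub>presented_monoid X R\<^esub> = pres_class X R []"
    by (simp add: presented_monoid_def)
  show ?thesis
  proof (rule monoidI)
    fix A B assume "A \<in> carrier (presented_monoid X R)" "B \<in> carrier (presented_monoid X R)"
    then obtain u v where "u \<in> lists X" "v \<in> lists X" "A = pres_class X R u" "B = pres_class X R v"
      unfolding car by blast
    then show "A \<otimes>\<^bsub>presented_monoid X R\<^esub> B \<in> carrier (presented_monoid X R)"
      unfolding car by (simp only: presented_monoid_mult_class) (simp del: in_lists_conv_set)
  next
    show "\<one>\<^bsub>presented_monoid X R\<^esub> \<in> carrier (presented_monoid X R)"
      unfolding car one by (rule imageI) (rule lists.Nil)
  next
    fix A B C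
    assume "A \<in> carrier (presented_monoid X R)" "B \<in> carrier (presented_monoid X R)"
      "C \<in> carrier (presented_monoid X R)"
    then obtain u v w where uvw: "u \<in> lists X" "v \<in> lists X" "w \<in> lists X"
      "A = pres_class X R u" "B = pres_class X R v" "C = pres_class X R w"
      unfolding car by blast
    then have "u @ v \<in> lists X" "v @ w \<in> lists X"
      by auto
    with uvw show "(A \<otimes>\<^bsub>presented_monoid X R\<^esub> B) \<otimes>\<^bsub>presented_monoid X R\<^esub> C
        = A \<otimes>\<^bsub>presented_monoid X R\<^esub> (B \<otimes>\<^bsub>presented_monoid X R\<^esub> C)"
      by (simp only: presented_monoid_mult_class append_assoc)
  next
    fix A assume "A \<in> carrier (presented_monoid X R)"
    then obtain u where u: "u \<in> lists X" "A = pres_class X R u"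
      unfolding car by blast
    show "\<one>\<^bsub>presented_monoid X R\<^esub> \<otimes>\<^bsub>presented_monoid X R\<^esub> A = A"
      using u by (simp only: one presented_monoid_mult_class lists.Nil append_Nil)
    show "A \<otimes>\<^bsub>presented_monoid X R\<^esub> \<one>\<^bsub>presented_monoid X R\<^esub> = A"
      using u by (simp only: one presented_monoid_mult_class lists.Nil append_Nil2)
  qed
qed


section \<open>The partition monoid and the Brauer monoid\<close>

text \<open>\<open>Le i\<close> stands for the point \<open>i\<close> of \<open>M\<close>, \<open>Ri i\<close> for the point \<open>i'\<close> of \<open>M'\<close>. The points \<open>Mid i\<close>
  form the middle row that occurs only while a product is computed.\<close>

datatype point = Le nat | Mid nat | Ri nat

definition points :: "nat \<Rightarrow> point set" where
  "points n = Le ` {1..n} \<union> Ri ` {1..n}"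

definition points3 :: "nat \<Rightarrow> point set" where
  "points3 n = Le ` {1..n} \<union> Mid ` {1..n} \<union> Ri ` {1..n}"

definition block_rel :: "'a set set \<Rightarrow> ('a \<times> 'a) set" where
  "block_rel P = {(x, y). \<exists>B\<in>P. x \<in> B \<and> y \<in> B}"

fun right_to_mid :: "point \<Rightarrow> point" where
  "right_to_mid (Ri i) = Mid i"
| "right_to_mid p = p"

fun left_to_mid :: "point \<Rightarrow> point" where
  "left_to_mid (Le i) = Mid i"
| "left_to_mid p = p"

definition glue_rel :: "nat \<Rightarrow> point set set \<Rightarrow> point set set \<Rightarrow> (point \<times> point) set" where
  "glue_rel n \<alpha> \<beta> = \<Inter> {r. equiv (points3 n) r
      \<and> map_prod right_to_mid right_to_mid ` block_rel \<alpha> \<subseteq> r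
      \<and> map_prod left_to_mid left_to_mid ` block_rel \<beta> \<subseteq> r}"

definition partition_mult :: "nat \<Rightarrow> point set set \<Rightarrow> point set set \<Rightarrow> point set set" where
  "partition_mult n \<alpha> \<beta> = points n // (glue_rel n \<alpha> \<beta> \<inter> points n \<times> points n)"

definition partition_monoid :: "nat \<Rightarrow> point set set monoid" where
  "partition_monoid n =
    \<lparr>carrier = {\<alpha>. partition_on (points n) \<alpha>},
     mult = partition_mult n,
     one = {{Le j, Ri j} | j. j \<in> {1..n}}\<rparr>"

definition brauer_monoid :: "nat \<Rightarrow> point set set monoid" where
  "brauer_monoid n = (partition_monoid n)
    \<lparr>carrier := {\<alpha> \<in> carrier (partition_monoid n). \<forall>B\<in>\<alpha>. card B = 2}\<rparr>"

definition brauer_s :: "nat \<Rightarrow> nat \<Rightarrow> point set set" where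
  "brauer_s n i = {{Le i, Ri (i + 1)}, {Le (i + 1), Ri i}}
     \<union> {{Le j, Ri j} | j. j \<in> {1..n} \<and> j \<noteq> i \<and> j \<noteq> i + 1}"

definition brauer_pi :: "nat \<Rightarrow> nat \<Rightarrow> point set set" where
  "brauer_pi n i = {{Le i, Le (i + 1)}, {Ri i, Ri (i + 1)}}
     \<union> {{Le j, Ri j} | j. j \<in> {1..n} \<and> j \<noteq> i \<and> j \<noteq> i + 1}"


section \<open>The presentation\<close>

datatype gen = \<sigma> nat | \<theta> nat

definition gens :: "nat \<Rightarrow> gen set" where
  "gens n = \<sigma> ` {1..n - 1} \<union> \<theta> ` {1..n - 1}"

abbreviation far :: "nat \<Rightarrow> nat \<Rightarrow> bool" where
  "far i j \<equiv> \<bar>int i - int j\<bar> > 1"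

abbreviation adjacent :: "nat \<Rightarrow> nat \<Rightarrow> bool" where
  "adjacent i j \<equiv> \<bar>int i - int j\<bar> = 1"

inductive_set T_rels :: "nat \<Rightarrow> (gen list \<times> gen list) set" for n :: nat where
  "i \<in> {1..n - 1} \<Longrightarrow> ([\<sigma> i, \<sigma> i], []) \<in> T_rels n"
| "i \<in> {1..n - 1} \<Longrightarrow> j \<in> {1..n - 1} \<Longrightarrow> far i j
    \<Longrightarrow> ([\<sigma> i, \<sigma> j], [\<sigma> j, \<sigma> i]) \<in> T_rels n"
| "i \<in> {1..n - 1} \<Longrightarrow> j \<in> {1..n - 1} \<Longrightarrow> adjacent i j
    \<Longrightarrow> ([\<sigma> i, \<sigma> j, \<sigma> i], [\<sigma> j, \<sigma> i, \<sigma> j]) \<in> T_rels n"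
| "i \<in> {1..n - 1} \<Longrightarrow> ([\<theta> i, \<theta> i], [\<theta> i]) \<in> T_rels n"
| "i \<in> {1..n - 1} \<Longrightarrow> j \<in> {1..n - 1} \<Longrightarrow> far i j
    \<Longrightarrow> ([\<theta> i, \<theta> j], [\<theta> j, \<theta> i]) \<in> T_rels n"
| "i \<in> {1..n - 1} \<Longrightarrow> j \<in> {1..n - 1} \<Longrightarrow> adjacent i j
    \<Longrightarrow> ([\<theta> i, \<theta> j, \<theta> i], [\<theta> i]) \<in> T_rels n"
| "i \<in> {1..n - 1} \<Longrightarrow> ([\<theta> i, \<sigma> i], [\<theta> i]) \<in> T_rels n"
| "i \<in> {1..n - 1} \<Longrightarrow> ([\<sigma> i, \<theta> i], [\<theta> i]) \<in> T_rels n"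
| "i \<in> {1..n - 1} \<Longrightarrow> j \<in> {1..n - 1} \<Longrightarrow> far i j
    \<Longrightarrow> ([\<theta> i, \<sigma> j], [\<sigma> j, \<theta> i]) \<in> T_rels n"
| "i \<in> {1..n - 1} \<Longrightarrow> j \<in> {1..n - 1} \<Longrightarrow> adjacent i j
    \<Longrightarrow> ([\<sigma> i, \<theta> j, \<theta> i], [\<sigma> j, \<theta> i]) \<in> T_rels n"
| "i \<in> {1..n - 1} \<Longrightarrow> j \<in> {1..n - 1} \<Longrightarrow> adjacent i j
    \<Longrightarrow> ([\<theta> i, \<theta> j, \<sigma> i], [\<theta> i, \<sigma> j]) \<in> T_rels n"

definition T_monoid :: "nat \<Rightarrow> gen list set monoid" where
  "T_monoid n = presented_monoid (gens n) (T_rels n)"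

definition T_class :: "nat \<Rightarrow> gen list \<Rightarrow> gen list set" where
  "T_class n w = pres_class (gens n) (T_rels n) w"

end

theory Submission
  imports Defs "HOL-Combinatorics.Permutations"
begin

text \<open>
  Write a Brauer diagram as an equivalence relation on the \<open>2n\<close> points. Multiplication by \<open>s\<^sub>i\<close> on the
  left relabels the left points; multiplication by \<open>\<pi>\<^sub>i\<close> merges the classes of the left points \<open>i\<close> and
  \<open>i + 1\<close>, removes these two points from the result and makes them a class of their own.

  For injectivity, let words act on an arbitrary set on which the relations hold. By the Coxeter
  presentation the \<open>\<sigma>\<^sub>i\<close> give an action of \<open>S\<^sub>n\<close>, and conjugating \<open>\<theta>\<^sub>n\<^sub>-\<^sub>1\<close> by permutations gives an
  operator \<open>\<theta>\<^sub>a\<^sub>b\<close> for every pair \<open>{a, b}\<close>. These operators are idempotent, commute for disjoint pairs and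
  satisfy \<open>\<theta>\<^sub>a\<^sub>b \<theta>\<^sub>b\<^sub>c = \<theta>\<^sub>a\<^sub>b (a c)\<close>. Hence every word acts as \<open>\<theta>\<^sub>P p\<close>, where \<open>\<theta>\<^sub>P\<close> is the product over a set \<open>P\<close>
  of disjoint pairs and \<open>p\<close> is a permutation. The diagram of the word determines \<open>P\<close>, and it determines
  \<open>p\<close> up to permutations which preserve \<open>P\<close> and fix all points outside of it. Such permutations are
  products of \<open>(a b)\<close> and \<open>(a c)(b d)\<close> with \<open>{a, b}, {c, d} \<in> P\<close>, and \<open>\<theta>\<^sub>P\<close> absorbs both of these.

  For surjectivity, a diagram without brackets is a permutation, and a diagram with a left bracket is
  obtained from one with fewer brackets by multiplying with some \<open>\<pi>\<^sub>a\<^sub>b\<close>.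
\<close>

section \<open>Cup-cap surgery on equivalence relations\<close>

text \<open>Equations in a presented monoid are awkward to handle on words; as equations between
  operators they are applied pointwise. Left multiplication on the classes of words is the action
  that matters in the end, because a word applied to the class of the empty word returns its own
  class.

  The base operator sits at \<open>{n - 1, n}\<close> because the other points then form the initial
  segment \<open>{1..n - 2}\<close>, whose permutations are words in letters commuting with \<theta>
  at \<open>n - 1\<close> by the defining relations. With the transposition of \<open>n - 1\<close>
  and \<open>n\<close>, which that operator absorbs on both sides, they generate the stabiliser of
  the pair. This is what makes the conjugates depend on the pair alone.

  Surgery is defined at two arbitrary points of an arbitrary relation. The defining relations can
  then be checked for all equivalence relations, with no record of block sizes, and a surgery at one
  left and one right point, which is no generator, becomes available for surjectivity. The identity
  \<open>cup_cap_cup_cap\<close> is the common source of most relations between surgeries.\<close>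

definition cup_cap :: "'a \<Rightarrow> 'a \<Rightarrow> ('a \<times> 'a) set \<Rightarrow> ('a \<times> 'a) set" where
  "cup_cap u v R = {(x, y). if x \<in> {u, v} \<or> y \<in> {u, v} then x \<in> {u, v} \<and> y \<in> {u, v}
     else (x, y) \<in> R \<or> (x, u) \<in> R \<and> (v, y) \<in> R \<or> (x, v) \<in> R \<and> (u, y) \<in> R}"

lemma cup_cap_swap: "cup_cap u v R = cup_cap v u R"
  unfolding cup_cap_def by auto

lemma equiv_iff_refl_sym_trans:
  "equiv A R \<longleftrightarrow> R \<subseteq> A \<times> A \<and> (\<forall>x\<in>A. (x, x) \<in> R) \<and> (\<forall>x y. (x, y) \<in> R \<longrightarrow> (y, x) \<in> R)
     \<and> (\<forall>x y z. (x, y) \<in> R \<longrightarrow> (y, z) \<in> R \<longrightarrow> (x, z) \<in> R)"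
  unfolding equiv_def refl_on_def Relation.sym_def Relation.trans_def by blast

text \<open>A representative chosen from each class serves as its label. Membership in
  \<open>R\<close> becomes an equation, and the surgery lemmas become case distinctions about
  equality.\<close>

lemma equiv_class_label:
  fixes R :: "('a \<times> 'a) set"
  assumes "equiv A R"
  obtains c :: "'a \<Rightarrow> 'a" where "\<And>x y. x \<in> A \<Longrightarrow> y \<in> A \<Longrightarrow> (x, y) \<in> R \<longleftrightarrow> c x = c y"
proof (rule that)
  fix x y assume xy: "x \<in> A" "y \<in> A"
  have in_class: "(z, SOME w. w \<in> R `` {z}) \<in> R" if "z \<in> A" for z
    using someI[of "\<lambda>w. w \<in> R `` {z}" z] equiv_class_self[OF assms that] by simp
  have "R `` {x} = R `` {y} \<longleftrightarrow> (x, y) \<in> R"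
    using eq_equiv_class_iff[OF assms xy] .
  then show "(x, y) \<in> R \<longleftrightarrow> (SOME w. w \<in> R `` {x}) = (SOME w. w \<in> R `` {y})"
    using in_class[OF xy(1)] in_class[OF xy(2)] assms unfolding equiv_iff_refl_sym_trans by metis
qed

lemma equiv_cup_cap:
  fixes R :: "('a \<times> 'a) set"
  assumes "equiv A R" "u \<in> A" "v \<in> A"
  shows "equiv A (cup_cap u v R)"
proof -
  have R: "R \<subseteq> A \<times> A" "\<And>x. x \<in> A \<Longrightarrow> (x, x) \<in> R" "\<And>x y. (x, y) \<in> R \<Longrightarrow> (y, x) \<in> R"
    using assms(1) unfolding equiv_iff_refl_sym_trans by blast+
  obtain c :: "'a \<Rightarrow> 'a" where c: "\<And>x y. x \<in> A \<Longrightarrow> y \<in> A \<Longrightarrow> (x, y) \<in> R \<longleftrightarrow> c x = c y"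
    using equiv_class_label[OF assms(1)] by metis
  have sub: "cup_cap u v R \<subseteq> A \<times> A"
    using R(1) assms(2,3) unfolding cup_cap_def by (auto split: if_splits)
  have "(x, z) \<in> cup_cap u v R" if "(x, y) \<in> cup_cap u v R" "(y, z) \<in> cup_cap u v R" for x y z
  proof -
    have "x \<in> A" "y \<in> A" "z \<in> A"
      using that sub by auto
    then show ?thesis
      using that assms(2,3)
      unfolding cup_cap_def mem_Collect_eq prod.case insert_iff empty_iff by (smt (verit) c)
  qed
  moreover have "(x, x) \<in> cup_cap u v R" if "x \<in> A" for x
    using R(2) that unfolding cup_cap_def by simp
  moreover have "(y, x) \<in> cup_cap u v R" if "(x, y) \<in> cup_cap u v R" for x y
    using R(3) that unfolding cup_cap_def by (auto split: if_splits)
  ultimately show ?thesis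
    unfolding equiv_iff_refl_sym_trans using sub by blast
qed

lemma cup_cap_idem:
  "cup_cap u v (cup_cap u v R) = cup_cap u v R"
  unfolding cup_cap_def by auto

lemma cup_cap_absorb:
  assumes "equiv A R" "R `` {u} = {u, v}"
  shows "cup_cap u v R = R"
proof -
  have R: "(x, y) \<in> R \<Longrightarrow> (y, x) \<in> R" "(x, y) \<in> R \<Longrightarrow> (y, z) \<in> R \<Longrightarrow> (x, z) \<in> R" for x y z
    using assms(1) unfolding equiv_iff_refl_sym_trans by blast+
  have u: "(u, x) \<in> R \<longleftrightarrow> x \<in> {u, v}" for x
    using assms(2) by blast
  have v: "(v, x) \<in> R \<longleftrightarrow> x \<in> {u, v}" for x
    using u[of x] u[of v] R(1)[of u v] R(2)[of u v x] R(2)[of v u x] by blast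
  have "(x, y) \<in> cup_cap u v R \<longleftrightarrow> (x, y) \<in> R" for x y
  proof (cases "x \<in> {u, v} \<or> y \<in> {u, v}")
    case True
    have "(x, y) \<in> R \<longleftrightarrow> x \<in> {u, v} \<and> y \<in> {u, v}"
      using True u[of x] u[of y] v[of x] v[of y] R(1)[of x y] R(1)[of y x] by blast
    then show ?thesis using True unfolding cup_cap_def by simp
  next
    case False
    then have "(x, u) \<notin> R" "(x, v) \<notin> R"
      using u[of x] v[of x] R(1)[of x] by blast+
    then show ?thesis using False unfolding cup_cap_def by simp
  qed
  then show ?thesis by auto
qed

lemma cup_cap_commute:
  fixes R :: "('a \<times> 'a) set"
  assumes "equiv A R" "distinct [u, v, w, z]" "{u, v, w, z} \<subseteq> A"
  shows "cup_cap u v (cup_cap w z R) = cup_cap w z (cup_cap u v R)"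
proof -
  obtain c :: "'a \<Rightarrow> 'a" where c: "\<And>x y. x \<in> A \<Longrightarrow> y \<in> A \<Longrightarrow> (x, y) \<in> R \<longleftrightarrow> c x = c y"
    using equiv_class_label[OF assms(1)] by metis
  \<comment> \<open>One inclusion for arbitrary points suffices: exchanging the two pairs gives the
    other.\<close>
  have *: "(x, y) \<in> cup_cap w z (cup_cap u v R)" if "(x, y) \<in> cup_cap u v (cup_cap w z R)"
    "distinct [u, v, w, z]" "{u, v, w, z} \<subseteq> A" for x y u v w z
  proof -
    have "equiv A (cup_cap u v (cup_cap w z R))"
      using that(3) by (intro equiv_cup_cap assms(1)) auto
    then have "x \<in> A" "y \<in> A"
      using that(1) equiv_type by blast+
    then show ?thesis
      using that unfolding cup_cap_def mem_Collect_eq prod.case insert_iff empty_iff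
      by (smt (verit) c distinct_length_2_or_more insert_subset)
  qed
  show ?thesis
    using assms(2,3) by (intro equalityI subrelI) (rule *, assumption, force, force)+
qed

section \<open>Surgery and relabelling\<close>

lemma inv_image_comp: "inv_image (inv_image R f) g = inv_image R (f \<circ> g)"
  by auto

lemma equiv_inv_image:
  assumes "equiv A R" "\<And>x. f x \<in> A \<longleftrightarrow> x \<in> B"
  shows "equiv B (inv_image R f)"
proof -
  have "inv_image R f \<subseteq> B \<times> B"
    using equiv_type[OF assms(1)] assms(2) by (auto simp: inv_image_def)
  then show ?thesis
    using assms unfolding equiv_iff_refl_sym_trans in_inv_image by blast
qed

text \<open>On both sides \<open>w\<close> takes over the place of \<open>u\<close>, the classes of
  \<open>v\<close> and \<open>w\<close> in \<open>R\<close> are merged, and \<open>{u, v}\<close> is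
  split off.\<close>

lemma cup_cap_cup_cap:
  fixes R :: "('a \<times> 'a) set"
  assumes "equiv A R" "distinct [u, v, w]" "{u, v, w} \<subseteq> A"
  shows "cup_cap u v (cup_cap v w R) = cup_cap u v (inv_image R (transpose u w))"
proof -
  obtain c :: "'a \<Rightarrow> 'a" where c: "\<And>x y. x \<in> A \<Longrightarrow> y \<in> A \<Longrightarrow> (x, y) \<in> R \<longleftrightarrow> c x = c y"
    using equiv_class_label[OF assms(1)] by metis
  have A: "transpose u w x \<in> A \<longleftrightarrow> x \<in> A" for x
    using assms(3) by (auto simp: transpose_def)
  have "equiv A (cup_cap u v (cup_cap v w R))"
    "equiv A (cup_cap u v (inv_image R (transpose u w)))"
    using assms(3) A by (auto intro!: equiv_cup_cap assms(1) equiv_inv_image)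
  then have sub: "cup_cap u v (cup_cap v w R) \<subseteq> A \<times> A"
    "cup_cap u v (inv_image R (transpose u w)) \<subseteq> A \<times> A"
    by (simp_all add: equiv_type)
  have "(x, y) \<in> cup_cap u v (cup_cap v w R)
      \<longleftrightarrow> (x, y) \<in> cup_cap u v (inv_image R (transpose u w))" if "x \<in> A" "y \<in> A" for x y
    using assms(2,3) that A[of x] A[of y]
    unfolding cup_cap_def mem_Collect_eq prod.case insert_iff empty_iff in_inv_image
    by (smt (verit) c distinct_length_2_or_more insert_subset transpose_def)
  with sub show ?thesis by blast
qed

lemma cup_cap_inv_image:
  assumes "inj f"
  shows "cup_cap u v (inv_image R f) = inv_image (cup_cap (f u) (f v) R) f"
  using assms unfolding cup_cap_def by (auto simp: inj_eq split: if_splits)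

section \<open>Diagrams as equivalence relations\<close>

lemma points_simps [simp]:
  "Le i \<in> points n \<longleftrightarrow> i \<in> {1..n}" "Ri i \<in> points n \<longleftrightarrow> i \<in> {1..n}" "Mid i \<notin> points n"
  by (auto simp: points_def)

lemma points3_simps [simp]:
  "Le i \<in> points3 n \<longleftrightarrow> i \<in> {1..n}" "Ri i \<in> points3 n \<longleftrightarrow> i \<in> {1..n}" "Mid i \<in> points3 n \<longleftrightarrow> i \<in> {1..n}"
  by (auto simp: points3_def)

lemma points_cases:
  assumes "x \<in> points n"
  obtains (Le) i where "x = Le i" "i \<in> {1..n}" | (Ri) i where "x = Ri i" "i \<in> {1..n}"
  using assms unfolding points_def by blast

lemma points_subset_points3: "points n \<subseteq> points3 n"
  by (auto simp: points_def points3_def)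

lemma block_rel_quotient:
  assumes "equiv A r"
  shows "block_rel (A // r) = r"
proof (intro equalityI subrelI)
  fix x y assume "(x, y) \<in> block_rel (A // r)"
  then obtain z where "(z, x) \<in> r" "(z, y) \<in> r"
    unfolding block_rel_def quotient_def by auto
  then show "(x, y) \<in> r"
    using assms unfolding equiv_iff_refl_sym_trans by blast
next
  fix x y assume "(x, y) \<in> r"
  moreover from this have "x \<in> A" "(x, x) \<in> r"
    using assms unfolding equiv_iff_refl_sym_trans by blast+
  ultimately show "(x, y) \<in> block_rel (A // r)"
    unfolding block_rel_def quotient_def by auto
qed

section \<open>Gluing in terms of paths\<close>

definition glue_edges :: "(point \<times> point) set \<Rightarrow> (point \<times> point) set \<Rightarrow> (point \<times> point) set" where
  "glue_edges r q = map_prod right_to_mid right_to_mid ` r \<union> map_prod left_to_mid left_to_mid ` q"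

definition mult_rel :: "nat \<Rightarrow> (point \<times> point) set \<Rightarrow> (point \<times> point) set \<Rightarrow> (point \<times> point) set" where
  "mult_rel n r q = (glue_edges r q)\<^sup>* \<inter> points n \<times> points n"

lemma sym_glue_edges:
  assumes "equiv A r" "equiv A q"
  shows "sym (glue_edges r q)"
proof -
  have sym_image: "sym (map_prod f f ` r)" if "sym r" for f :: "point \<Rightarrow> point" and r
    using that by (auto intro!: symI dest: symD)
  have "sym r" "sym q" using assms by (auto elim: equivE)
  then show ?thesis
    unfolding glue_edges_def by (intro sym_Un sym_image)
qed

lemma glue_edges_subset:
  assumes "r \<subseteq> points n \<times> points n" "q \<subseteq> points n \<times> points n"
  shows "glue_edges r q \<subseteq> points3 n \<times> points3 n"
proof -
  have "right_to_mid x \<in> points3 n" "left_to_mid x \<in> points3 n" if "x \<in> points n" for x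
    using that by (cases rule: points_cases; simp)+
  then show ?thesis using assms unfolding glue_edges_def by fastforce
qed

lemma equiv_rtrancl_Int:
  assumes "sym E"
  shows "equiv A (E\<^sup>* \<inter> A \<times> A)"
proof -
  have "sym (E\<^sup>*)" using assms by (rule sym_rtrancl)
  then show ?thesis
    unfolding equiv_iff_refl_sym_trans Relation.sym_def by (blast intro: rtrancl_trans)
qed

lemma rtrancl_subset_equiv:
  assumes "equiv A G" "E \<subseteq> G"
  shows "E\<^sup>* \<inter> A \<times> A \<subseteq> G"
proof clarify
  fix x y assume "(x, y) \<in> E\<^sup>*" "x \<in> A" "y \<in> A"
  from this(1) have "(x, y) \<in> G"
  proof induction
    case base
    then show ?case using \<open>x \<in> A\<close> assms(1) unfolding equiv_iff_refl_sym_trans by blast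
  next
    case (step y z)
    then show ?case using assms unfolding equiv_iff_refl_sym_trans by blast
  qed
  then show "(x, y) \<in> G" .
qed

lemma equiv_mult_rel:
  assumes "equiv (points n) r" "equiv (points n) q"
  shows "equiv (points n) (mult_rel n r q)"
  unfolding mult_rel_def by (intro equiv_rtrancl_Int sym_glue_edges[OF assms])

text \<open>The edges form a symmetric relation, so their reflexive transitive closure, cut down to
  the three rows, is already the smallest equivalence relation, which \<open>glue_rel\<close>
  describes as an intersection.\<close>

lemma partition_mult_quotient:
  assumes "equiv (points n) r" "equiv (points n) q"
  shows "partition_mult n (points n // r) (points n // q) = points n // mult_rel n r q"
proof -
  let ?E = "glue_edges r q"
  have sub: "?E \<subseteq> points3 n \<times> points3 n"
    using assms equiv_type by (intro glue_edges_subset) blast+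
  have "glue_rel n (points n // r) (points n // q) = ?E\<^sup>* \<inter> points3 n \<times> points3 n"
    unfolding glue_rel_def block_rel_quotient[OF assms(1)] block_rel_quotient[OF assms(2)]
  proof (intro equalityI Inter_lower Inter_greatest CollectI conjI)
    show "equiv (points3 n) (?E\<^sup>* \<inter> points3 n \<times> points3 n)"
      by (intro equiv_rtrancl_Int sym_glue_edges[OF assms])
    show "map_prod right_to_mid right_to_mid ` r \<subseteq> ?E\<^sup>* \<inter> points3 n \<times> points3 n"
      "map_prod left_to_mid left_to_mid ` q \<subseteq> ?E\<^sup>* \<inter> points3 n \<times> points3 n"
      using sub unfolding glue_edges_def by blast+
  next
    fix G assume "G \<in> {G. equiv (points3 n) G \<and> map_prod right_to_mid right_to_mid ` r \<subseteq> G
      \<and> map_prod left_to_mid left_to_mid ` q \<subseteq> G}"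
    then show "?E\<^sup>* \<inter> points3 n \<times> points3 n \<subseteq> G"
      by (intro rtrancl_subset_equiv) (auto simp: glue_edges_def)
  qed
  moreover have "\<And>S. S \<inter> points3 n \<times> points3 n \<inter> points n \<times> points n = S \<inter> points n \<times> points n"
    using points_subset_points3 by blast
  ultimately show ?thesis
    unfolding partition_mult_def mult_rel_def by simp
qed

subsection \<open>Associativity\<close>

text \<open>Associativity needs four rows, but \<open>point\<close> offers only three. Numbered rows
  allow several diagrams to be stacked in one picture.\<close>

fun place :: "nat \<Rightarrow> nat \<Rightarrow> nat \<Rightarrow> point \<Rightarrow> nat \<times> nat" where
  "place k l m (Le i) = (k, i)"
| "place k l m (Mid i) = (l, i)"
| "place k l m (Ri i) = (m, i)"

lemma inj_place:
  assumes "distinct [k, l, m]"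
  shows "inj (place k l m)"
proof (rule injI)
  fix x y assume "place k l m x = place k l m y"
  then show "x = y" using assms by (cases x; cases y) auto
qed

text \<open>The row assigned to middle points is a dummy value, since relations on
  \<open>points n\<close> contain none; \<open>rows_eq\<close> replaces it by a row that makes the
  placement injective.\<close>

definition rows :: "nat \<Rightarrow> nat \<Rightarrow> (point \<times> point) set \<Rightarrow> ((nat \<times> nat) \<times> nat \<times> nat) set" where
  "rows k m r = map_prod (place k m m) (place k m m) ` r"

lemma rows_eq:
  assumes "r \<subseteq> points n \<times> points n"
  shows "rows k m r = map_prod (place k l m) (place k l m) ` r"
proof -
  have "place k m m x = place k l m x" if "x \<in> points n" for x
    using that by (cases rule: points_cases) auto
  then show ?thesis using assms unfolding rows_def by (intro image_cong) auto
qed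

lemma place_right_to_mid:
  assumes "r \<subseteq> points n \<times> points n"
  shows "map_prod (place k l m) (place k l m) ` map_prod right_to_mid right_to_mid ` r = rows k l r"
proof -
  have "place k l m (right_to_mid x) = place k l l x" if "x \<in> points n" for x
    using that by (cases rule: points_cases) auto
  then show ?thesis using assms unfolding rows_def image_image by (intro image_cong) auto
qed

lemma place_left_to_mid:
  assumes "r \<subseteq> points n \<times> points n"
  shows "map_prod (place k l m) (place k l m) ` map_prod left_to_mid left_to_mid ` r = rows l m r"
proof -
  have "place k l m (left_to_mid x) = place l m m x" if "x \<in> points n" for x
    using that by (cases rule: points_cases) auto
  then show ?thesis using assms unfolding rows_def image_image by (intro image_cong) auto
qed

lemma map_prod_rtrancl:
  assumes "inj f"
  shows "map_prod f f ` (E\<^sup>* \<inter> A \<times> A) = (map_prod f f ` E)\<^sup>* \<inter> f ` A \<times> f ` A"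
proof (intro equalityI subsetI)
  fix p assume "p \<in> map_prod f f ` (E\<^sup>* \<inter> A \<times> A)"
  then obtain x y where xy: "p = (f x, f y)" "(x, y) \<in> E\<^sup>*" "x \<in> A" "y \<in> A" by auto
  from xy(2) have "(f x, f y) \<in> (map_prod f f ` E)\<^sup>*"
  proof induction
    case (step y z)
    then have "(f y, f z) \<in> map_prod f f ` E" by force
    with step.IH show ?case by (rule rtrancl_into_rtrancl)
  qed simp
  then show "p \<in> (map_prod f f ` E)\<^sup>* \<inter> f ` A \<times> f ` A" using xy by auto
next
  fix p assume "p \<in> (map_prod f f ` E)\<^sup>* \<inter> f ` A \<times> f ` A"
  then obtain x y where xy: "p = (f x, f y)" "(f x, f y) \<in> (map_prod f f ` E)\<^sup>*" "x \<in> A" "y \<in> A"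
    by auto
  from xy(2) have "\<exists>z. f y = f z \<and> (x, z) \<in> E\<^sup>*"
  proof (induction "f y" arbitrary: y)
    case base
    then show ?case by (metis rtrancl.rtrancl_refl)
  next
    case (step w)
    from step.hyps(2) obtain u v where uv: "w = f u" "f y = f v" "(u, v) \<in> E" by auto
    from step.hyps(3)[OF uv(1)] obtain z where "f u = f z" "(x, z) \<in> E\<^sup>*" using uv by auto
    then have "(x, v) \<in> E\<^sup>*" using uv(3) injD[OF assms] rtrancl_into_rtrancl by metis
    then show ?case using uv(2) by blast
  qed
  then have "(x, y) \<in> E\<^sup>*" using injD[OF assms] by blast
  then show "p \<in> map_prod f f ` (E\<^sup>* \<inter> A \<times> A)" using xy by auto
qed

lemma rows_mult_rel:
  assumes "r \<subseteq> points n \<times> points n" "q \<subseteq> points n \<times> points n" "distinct [k, l, m]"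
  shows "rows k m (mult_rel n r q)
    = (rows k l r \<union> rows l m q)\<^sup>* \<inter> ({k, m} \<times> {1..n}) \<times> ({k, m} \<times> {1..n})"
proof -
  have "place k l m ` points n = {k, m} \<times> {1..n}"
    unfolding points_def image_Un image_image by auto
  moreover have "map_prod (place k l m) (place k l m) ` glue_edges r q = rows k l r \<union> rows l m q"
    unfolding glue_edges_def image_Un place_right_to_mid[OF assms(1)] place_left_to_mid[OF assms(2)] ..
  moreover have "rows k m (mult_rel n r q) = map_prod (place k l m) (place k l m) ` mult_rel n r q"
    by (rule rows_eq) (auto simp: mult_rel_def)
  ultimately show ?thesis
    using map_prod_rtrancl[OF inj_place[OF assms(3)]] unfolding mult_rel_def by metis
qed

text \<open>A path between points of \<open>K\<close> splits into steps of \<open>E2\<close>, which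
  stay inside \<open>K\<close>, and stretches of \<open>E1\<close>. A nontrivial stretch has both
  ends in \<open>Field E1 \<inter> K\<close>, hence in \<open>L\<close>, and can be replaced by one
  contracted edge.\<close>

lemma rtrancl_contract:
  assumes "E2 \<subseteq> K \<times> K" "L \<subseteq> K" "Field E1 \<inter> K \<subseteq> L"
  shows "((E1\<^sup>* \<inter> L \<times> L) \<union> E2)\<^sup>* \<inter> K \<times> K = (E1 \<union> E2)\<^sup>* \<inter> K \<times> K"
proof (intro equalityI)
  have "(E1\<^sup>* \<inter> L \<times> L) \<union> E2 \<subseteq> (E1 \<union> E2)\<^sup>*"
    using rtrancl_mono[of E1 "E1 \<union> E2"] by blast
  then show "((E1\<^sup>* \<inter> L \<times> L) \<union> E2)\<^sup>* \<inter> K \<times> K \<subseteq> (E1 \<union> E2)\<^sup>* \<inter> K \<times> K"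
    using rtrancl_subset_rtrancl by blast
next
  let ?F = "(E1\<^sup>* \<inter> L \<times> L) \<union> E2"
  have jump: "(x, y) \<in> ?F\<^sup>*" if "(x, z) \<in> ?F\<^sup>*" "(z, y) \<in> E1\<^sup>*" "z \<in> K" "y \<in> K" for x y z
  proof (cases "z = y")
    case False
    then have "z \<in> Field E1" "y \<in> Field E1"
      using that(2) by (auto simp: Field_def elim: converse_rtranclE rtranclE)
    then have "(z, y) \<in> ?F" using that assms(3) by blast
    with that(1) show ?thesis by (rule rtrancl_into_rtrancl)
  qed (use that in simp)
  show "(E1 \<union> E2)\<^sup>* \<inter> K \<times> K \<subseteq> ?F\<^sup>* \<inter> K \<times> K"
  proof clarify
    fix x y assume "(x, y) \<in> (E1 \<union> E2)\<^sup>*" and K: "x \<in> K" "y \<in> K"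
    \<comment> \<open>Invariant: \<open>z\<close> is a point of \<open>K\<close> already reached by
      contracted steps, after which the path has used only \<open>E1\<close>.\<close>
    from this(1) have "\<exists>z\<in>K. (x, z) \<in> ?F\<^sup>* \<and> (z, y) \<in> E1\<^sup>*"
    proof induction
      case base
      then show ?case using K by blast
    next
      case (step y w)
      then obtain z where z: "z \<in> K" "(x, z) \<in> ?F\<^sup>*" "(z, y) \<in> E1\<^sup>*" by blast
      show ?case
      proof (cases "(y, w) \<in> E1")
        case True
        then show ?thesis using z by (meson rtrancl_into_rtrancl)
      next
        case False
        then have yw: "(y, w) \<in> E2" "y \<in> K" "w \<in> K" using step.hyps(2) assms(1) by auto
        then have "(x, w) \<in> ?F\<^sup>*" using jump[OF z(2,3,1)] by (meson UnI2 rtrancl_into_rtrancl)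
        then show ?thesis using yw(3) by blast
      qed
    qed
    then show "(x, y) \<in> ?F\<^sup>* \<inter> K \<times> K" using jump K by blast
  qed
qed

lemma rows_subset:
  assumes "r \<subseteq> points n \<times> points n"
  shows "rows k m r \<subseteq> ({k, m} \<times> {1..n}) \<times> ({k, m} \<times> {1..n})"
proof -
  have "place k m m x \<in> {k, m} \<times> {1..n}" if "x \<in> points n" for x
    using that by (cases rule: points_cases) auto
  then show ?thesis using assms unfolding rows_def by fastforce
qed

text \<open>Both bracketings are the restriction to the outer rows of one closure on four rows.\<close>

lemma mult_rel_assoc:
  assumes "r \<subseteq> points n \<times> points n" "q \<subseteq> points n \<times> points n" "u \<subseteq> points n \<times> points n"
  shows "mult_rel n (mult_rel n r q) u = mult_rel n r (mult_rel n q u)"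
proof -
  let ?N = "{1..n}"
  let ?P = "rows 0 1 r" and ?Q = "rows 1 2 q" and ?U = "rows 2 3 u"
  let ?J = "({0, 3} \<times> ?N) \<times> ({0, 3::nat} \<times> ?N)"
  note sub = rows_subset[OF assms(1), of 0 1] rows_subset[OF assms(2), of 1 2]
    rows_subset[OF assms(3), of 2 3]
  have mult_sub: "mult_rel n r' q' \<subseteq> points n \<times> points n" for r' q'
    by (auto simp: mult_rel_def)
  have F: "Field (?P \<union> ?Q) \<subseteq> {0, 1, 2} \<times> ?N" "Field (?Q \<union> ?U) \<subseteq> {1, 2, 3} \<times> ?N"
    using sub by (fastforce simp: Field_def)+
  have Int_K: "S \<inter> ?J = S \<inter> K \<times> K \<inter> ?J" if "{0, 3} \<times> ?N \<subseteq> K" for S K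
    using that by blast
  \<comment> \<open>\<open>?K\<close> omits row 1, hidden when \<open>r\<close> and \<open>q\<close>
    are multiplied first; \<open>?K'\<close> omits row 2, hidden when \<open>q\<close> and
    \<open>u\<close> are.\<close>
  let ?K = "{0, 2, 3::nat} \<times> ?N" and ?K' = "{0, 1, 3::nat} \<times> ?N"
  have "rows 0 3 (mult_rel n (mult_rel n r q) u)
      = (((?P \<union> ?Q)\<^sup>* \<inter> ({0, 2} \<times> ?N) \<times> ({0, 2} \<times> ?N)) \<union> ?U)\<^sup>* \<inter> ?K \<times> ?K \<inter> ?J"
    using rows_mult_rel[OF mult_sub assms(3), of 0 2 3] rows_mult_rel[OF assms(1,2), of 0 1 2]
      Int_K[of ?K] by auto
  also have "\<dots> = (?P \<union> ?Q \<union> ?U)\<^sup>* \<inter> ?K \<times> ?K \<inter> ?J"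
    by (subst rtrancl_contract) (use sub F in auto)
  also have "\<dots> = (?P \<union> ?Q \<union> ?U)\<^sup>* \<inter> ?J"
    using Int_K[of ?K] by auto
  also have "\<dots> = (?Q \<union> ?U \<union> ?P)\<^sup>* \<inter> ?K' \<times> ?K' \<inter> ?J"
    using Int_K[of ?K'] by (auto simp: Un_ac)
  also have "\<dots> = (((?Q \<union> ?U)\<^sup>* \<inter> ({1, 3} \<times> ?N) \<times> ({1, 3} \<times> ?N)) \<union> ?P)\<^sup>* \<inter> ?K' \<times> ?K' \<inter> ?J"
    by (subst rtrancl_contract) (use sub F in auto)
  also have "\<dots> = rows 0 3 (mult_rel n r (mult_rel n q u))"
    using rows_mult_rel[OF assms(1) mult_sub, of 0 1 3] rows_mult_rel[OF assms(2,3), of 1 2 3]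
      Int_K[of ?K'] by (auto simp: Un_commute)
  finally have "rows 0 3 (mult_rel n (mult_rel n r q) u) = rows 0 3 (mult_rel n r (mult_rel n q u))" .
  \<comment> \<open>The dummy middle row is set to 1, so that the placement is injective and can be
    cancelled.\<close>
  then have "map_prod (place 0 1 3) (place 0 1 3) ` mult_rel n (mult_rel n r q) u
      = map_prod (place 0 1 3) (place 0 1 3) ` mult_rel n r (mult_rel n q u)"
    using rows_eq[OF mult_sub, of 0 3 _ _ 1] by metis
  moreover have "inj (map_prod (place 0 1 3) (place 0 1 3))"
    by (intro prod.inj_map inj_place) auto
  ultimately show ?thesis by (simp only: inj_image_eq_iff)
qed

subsection \<open>Products with generators\<close>

fun index :: "point \<Rightarrow> nat" where
  "index (Le i) = i"
| "index (Mid i) = i"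
| "index (Ri i) = i"

definition id_rel :: "nat \<Rightarrow> (point \<times> point) set" where
  "id_rel n = {(x, y). x \<in> points n \<and> y \<in> points n \<and> index x = index y}"

fun map_left :: "(nat \<Rightarrow> nat) \<Rightarrow> point \<Rightarrow> point" where
  "map_left p (Le i) = Le (p i)"
| "map_left p x = x"

fun gen_act :: "gen \<Rightarrow> (point \<times> point) set \<Rightarrow> (point \<times> point) set" where
  "gen_act (\<sigma> i) R = inv_image R (map_left (transpose i (Suc i)))"
| "gen_act (\<theta> i) R = cup_cap (Le i) (Le (Suc i)) R"

definition word_rel :: "nat \<Rightarrow> gen list \<Rightarrow> (point \<times> point) set" where
  "word_rel n w = foldr gen_act w (id_rel n)"

lemma word_rel_simps [simp]:
  "word_rel n [] = id_rel n"
  "word_rel n (g # w) = gen_act g (word_rel n w)"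
  by (simp_all add: word_rel_def)

lemma equiv_id_rel: "equiv (points n) (id_rel n)"
  unfolding equiv_iff_refl_sym_trans id_rel_def by auto

lemma map_left_comp: "map_left p \<circ> map_left q = map_left (p \<circ> q)"
  by (rule ext, rename_tac x, case_tac x) auto

lemma map_left_id [simp]: "map_left id = id" "map_left (\<lambda>x. x) = id"
  by (rule ext, rename_tac x, case_tac x, auto)+

lemma map_left_in_points:
  assumes "\<And>j. p j \<in> {1..n} \<longleftrightarrow> j \<in> {1..n}"
  shows "map_left p x \<in> points n \<longleftrightarrow> x \<in> points n"
  using assms by (cases x) (auto simp del: atLeastAtMost_iff)

lemma inj_map_left:
  assumes "inj p"
  shows "inj (map_left p)"
proof (rule injI)
  fix x y assume "map_left p x = map_left p y"
  then show "x = y" using injD[OF assms] by (cases x; cases y) auto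
qed

lemma transpose_Suc_in:
  assumes "i \<in> {1..n - 1}"
  shows "transpose i (Suc i) j \<in> {1..n} \<longleftrightarrow> j \<in> {1..n}"
  using assms by (auto simp: transpose_def)

lemma gens_cases:
  assumes "g \<in> gens n"
  obtains (s) i where "g = \<sigma> i" "i \<in> {1..n - 1}" | (t) i where "g = \<theta> i" "i \<in> {1..n - 1}"
  using assms unfolding gens_def by blast

lemma equiv_map_left:
  assumes "equiv (points n) R" "\<And>j. p j \<in> {1..n} \<longleftrightarrow> j \<in> {1..n}"
  shows "equiv (points n) (inv_image R (map_left p))"
  using assms(1) map_left_in_points[OF assms(2)] by (rule equiv_inv_image)

lemma equiv_gen_act:
  assumes "g \<in> gens n" "equiv (points n) R"
  shows "equiv (points n) (gen_act g R)"
  using assms(1)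
proof (cases rule: gens_cases)
  case (s i)
  then show ?thesis using equiv_map_left[OF assms(2) transpose_Suc_in[OF s(2)]] by simp
next
  case (t i)
  then show ?thesis by (auto intro!: equiv_cup_cap[OF assms(2)])
qed

lemma equiv_word_rel:
  assumes "w \<in> lists (gens n)"
  shows "equiv (points n) (word_rel n w)"
  using assms by (induction) (simp_all add: equiv_id_rel equiv_gen_act)

fun mid_to_left :: "point \<Rightarrow> point" where
  "mid_to_left (Mid i) = Le i"
| "mid_to_left p = p"

lemma rtrancl_glue_edges_right:
  assumes "(x, y) \<in> R"
  shows "(left_to_mid x, left_to_mid y) \<in> (glue_edges S R)\<^sup>*"
  using assms unfolding glue_edges_def by force

lemma rtrancl_glue_edges_left:
  assumes "(x, y) \<in> S"
  shows "(right_to_mid x, right_to_mid y) \<in> (glue_edges S R)\<^sup>*"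
  using assms unfolding glue_edges_def by force

text \<open>A certificate in place of an analysis of all paths: any equivalence relation
  \<open>G\<close> containing the edges bounds the closure from above, and the paths exhibited for
  \<open>Q\<close> bound it from below.\<close>

lemma mult_rel_eqI:
  assumes eq: "equiv (points n) S" "equiv (points n) R"
    and G: "equiv (points3 n) G" "\<And>x y. (x, y) \<in> S \<Longrightarrow> (right_to_mid x, right_to_mid y) \<in> G"
      "\<And>x y. (x, y) \<in> R \<Longrightarrow> (left_to_mid x, left_to_mid y) \<in> G"
    and Q: "Q \<subseteq> points n \<times> points n" "G \<inter> points n \<times> points n \<subseteq> Q" "Q \<subseteq> (glue_edges S R)\<^sup>*"
  shows "mult_rel n S R = Q"
proof -
  have "(glue_edges S R)\<^sup>* \<inter> points3 n \<times> points3 n \<subseteq> G"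
    using G(2,3) by (intro rtrancl_subset_equiv G(1)) (auto simp: glue_edges_def)
  then have "(glue_edges S R)\<^sup>* \<inter> points n \<times> points n \<subseteq> Q"
    using Q(2) points_subset_points3 by blast
  then show ?thesis unfolding mult_rel_def using Q(1,3) by blast
qed

lemma mult_rel_perm:
  assumes p: "\<And>j. p j \<in> {1..n} \<longleftrightarrow> j \<in> {1..n}" and R: "equiv (points n) R"
  shows "mult_rel n (inv_image (id_rel n) (map_left p)) R = inv_image R (map_left p)"
proof (rule mult_rel_eqI)
  let ?S = "inv_image (id_rel n) (map_left p)"
  \<comment> \<open>\<open>?m\<close> collapses the three rows onto the two rows of
    \<open>R\<close>: \<open>Mid i\<close> becomes \<open>Le i\<close>, and \<open>Le i\<close>,
    which the permutation diagram joins to \<open>Mid (p i)\<close>, becomes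
    \<open>Le (p i)\<close>.\<close>
  let ?m = "\<lambda>x. mid_to_left (map_left p x)"
  have m: "?m x \<in> points n \<longleftrightarrow> x \<in> points3 n" for x
    using p by (cases x) (auto simp del: atLeastAtMost_iff)
  show S: "equiv (points n) ?S" by (rule equiv_map_left[OF equiv_id_rel p])
  show "equiv (points n) R" by fact
  show "equiv (points3 n) (inv_image R ?m)"
    using R m by (rule equiv_inv_image)
  have R_refl: "(x, x) \<in> R" if "x \<in> points n" for x
    using that R unfolding equiv_iff_refl_sym_trans by blast
  show "(right_to_mid x, right_to_mid y) \<in> inv_image R ?m" if "(x, y) \<in> ?S" for x y
  proof -
    have "?m (right_to_mid x) = ?m (right_to_mid y)" "?m (right_to_mid x) \<in> points n"
      using that p unfolding id_rel_def by (cases x; cases y; simp del: atLeastAtMost_iff)+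
    then show ?thesis using R_refl by simp
  qed
  show "(left_to_mid x, left_to_mid y) \<in> inv_image R ?m" if "(x, y) \<in> R" for x y
  proof -
    have "x \<in> points n" "y \<in> points n" using that equiv_type[OF R] by auto
    moreover have "?m (left_to_mid z) = z" if "z \<in> points n" for z
      using that by (cases rule: points_cases) auto
    ultimately show ?thesis using that by simp
  qed
  have m': "?m z = map_left p z" if "z \<in> points n" for z
    using that by (cases rule: points_cases) auto
  then show "inv_image R ?m \<inter> points n \<times> points n \<subseteq> inv_image R (map_left p)"
    by auto
  show "inv_image R (map_left p) \<subseteq> points n \<times> points n"
    using equiv_type[OF equiv_map_left[OF R p]] .
  show "inv_image R (map_left p) \<subseteq> (glue_edges ?S R)\<^sup>*"
  proof (rule subrelI)
    fix x y assume xy: "(x, y) \<in> inv_image R (map_left p)"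
    then have P: "x \<in> points n" "y \<in> points n"
      using equiv_type[OF equiv_map_left[OF R p]] by blast+
    have 1: "(z, left_to_mid (map_left p z)) \<in> (glue_edges ?S R)\<^sup>*" if "z \<in> points n" for z
      using that
    proof (cases rule: points_cases)
      case (Le i)
      have "(Le i, Ri (p i)) \<in> ?S" using Le p by (simp add: id_rel_def del: atLeastAtMost_iff)
      from rtrancl_glue_edges_left[OF this] show ?thesis using Le by simp
    qed auto
    have "sym ((glue_edges ?S R)\<^sup>*)" by (rule sym_rtrancl[OF sym_glue_edges[OF S R]])
    then have "(left_to_mid (map_left p y), y) \<in> (glue_edges ?S R)\<^sup>*"
      using 1[OF P(2)] by (rule symD)
    moreover have "(left_to_mid (map_left p x), left_to_mid (map_left p y)) \<in> (glue_edges ?S R)\<^sup>*"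
      using xy by (intro rtrancl_glue_edges_right) simp
    ultimately show "(x, y) \<in> (glue_edges ?S R)\<^sup>*"
      using 1[OF P(1)] rtrancl_trans by metis
  qed
qed

lemma mult_rel_id_rel:
  assumes "equiv (points n) R"
  shows "mult_rel n (id_rel n) R = R"
  using mult_rel_perm[of id n R] assms by (simp add: inv_image_def)

lemma mult_rel_cup_cap:
  assumes i: "i \<in> {1..n - 1}" and R: "equiv (points n) R"
  shows "mult_rel n (cup_cap (Le i) (Le (Suc i)) (id_rel n)) R = cup_cap (Le i) (Le (Suc i)) R"
proof (rule mult_rel_eqI)
  let ?C = "cup_cap (Le i) (Le (Suc i))"
  let ?S = "?C (id_rel n)"
  \<comment> \<open>The pullback along \<open>mid_to_left\<close> ties every left point to the
    middle point of the same index. The surgery then cuts off \<open>Le i\<close> and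
    \<open>Le (Suc i)\<close> and leaves \<open>Mid i\<close> and \<open>Mid (Suc i)\<close> in one
    merged class.\<close>
  let ?G = "?C (inv_image R mid_to_left)"
  have i': "Le i \<in> points n" "Le (Suc i) \<in> points n" "i \<in> {1..n}" "Suc i \<in> {1..n}"
    using i by auto
  show S: "equiv (points n) ?S" by (rule equiv_cup_cap[OF equiv_id_rel i'(1,2)])
  show "equiv (points n) R" by fact
  have R_refl: "(x, x) \<in> R" if "x \<in> points n" for x
    using that R unfolding equiv_iff_refl_sym_trans by blast
  have m: "mid_to_left x \<in> points n \<longleftrightarrow> x \<in> points3 n" for x
    by (cases x) auto
  have m': "mid_to_left z = z" if "z \<in> points n" for z
    using that by (cases rule: points_cases) auto
  have "equiv (points3 n) (inv_image R mid_to_left)"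
    using R m by (rule equiv_inv_image)
  then show "equiv (points3 n) ?G"
    using i' by (intro equiv_cup_cap) auto
  show "(right_to_mid x, right_to_mid y) \<in> ?G" if "(x, y) \<in> ?S" for x y
  proof -
    have "x \<in> points n" "y \<in> points n" using that equiv_type[OF S] by auto
    then show ?thesis
      using that i' R_refl
      by (elim points_cases; simp add: cup_cap_def id_rel_def split: if_splits) auto
  qed
  show "(left_to_mid x, left_to_mid y) \<in> ?G" if "(x, y) \<in> R" for x y
  proof -
    have "x \<in> points n" "y \<in> points n" using that equiv_type[OF R] by auto
    then show ?thesis
      using that by (elim points_cases; simp add: cup_cap_def)
  qed
  show "?G \<inter> points n \<times> points n \<subseteq> ?C R"
    using m' i' unfolding cup_cap_def by (auto split: if_splits)
  show CR: "?C R \<subseteq> points n \<times> points n"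
    using equiv_type[OF equiv_cup_cap[OF R i'(1,2)]] .
  show "?C R \<subseteq> (glue_edges ?S R)\<^sup>*"
  proof (rule subrelI)
    let ?E = "(glue_edges ?S R)\<^sup>*"
    fix x y assume xy: "(x, y) \<in> ?C R"
    then have P: "x \<in> points n" "y \<in> points n" using CR by blast+
    have sym: "sym ?E" by (rule sym_rtrancl[OF sym_glue_edges[OF S R]])
    have up: "(z, left_to_mid z) \<in> ?E" if "z \<in> points n" "z \<notin> {Le i, Le (Suc i)}" for z
      using that(1)
    proof (cases rule: points_cases)
      case (Le j)
      have "(Le j, Ri j) \<in> ?S" using Le that(2) by (simp add: id_rel_def cup_cap_def)
      from rtrancl_glue_edges_left[OF this] show ?thesis using Le by simp
    qed auto
    have "(Le i, Le (Suc i)) \<in> ?S" "(Ri i, Ri (Suc i)) \<in> ?S"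
      using i' by (simp_all add: cup_cap_def id_rel_def)
    from this[THEN rtrancl_glue_edges_left]
    have bracket: "(Le i, Le (Suc i)) \<in> ?E" "(Mid i, Mid (Suc i)) \<in> ?E"
      by simp_all
    show "(x, y) \<in> ?E"
    proof (cases "x \<in> {Le i, Le (Suc i)} \<or> y \<in> {Le i, Le (Suc i)}")
      case True
      then have "x \<in> {Le i, Le (Suc i)} \<and> y \<in> {Le i, Le (Suc i)}"
        using xy unfolding cup_cap_def by simp
      then show ?thesis using bracket(1) symD[OF sym] by auto
    next
      case False
      then have up': "(x, left_to_mid x) \<in> ?E" "(left_to_mid y, y) \<in> ?E"
        using up P symD[OF sym] by auto
      have "(left_to_mid x, left_to_mid y) \<in> ?E"
      proof -
        consider "(x, y) \<in> R" | "(x, Le i) \<in> R" "(Le (Suc i), y) \<in> R"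
          | "(x, Le (Suc i)) \<in> R" "(Le i, y) \<in> R"
          using xy False unfolding cup_cap_def by auto
        then show ?thesis
        proof cases
          case 1
          then show ?thesis by (rule rtrancl_glue_edges_right)
        next
          case 2
          from this[THEN rtrancl_glue_edges_right]
          have "(left_to_mid x, Mid i) \<in> ?E" "(Mid (Suc i), left_to_mid y) \<in> ?E"
            by simp_all
          then show ?thesis using bracket(2) by (meson rtrancl_trans)
        next
          case 3
          from this[THEN rtrancl_glue_edges_right]
          have "(left_to_mid x, Mid (Suc i)) \<in> ?E" "(Mid i, left_to_mid y) \<in> ?E"
            by simp_all
          then show ?thesis using symD[OF sym bracket(2)] by (meson rtrancl_trans)
        qed
      qed
      then show ?thesis using up' by (meson rtrancl_trans)
    qed
  qed
qed

lemma mult_rel_gen_act: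
  assumes "g \<in> gens n" "equiv (points n) R"
  shows "mult_rel n (gen_act g (id_rel n)) R = gen_act g R"
  using assms(1)
proof (cases rule: gens_cases)
  case (s i)
  then show ?thesis using mult_rel_perm[OF transpose_Suc_in[OF s(2)] assms(2)] by simp
next
  case (t i)
  then show ?thesis using mult_rel_cup_cap[OF t(2) assms(2)] by simp
qed

text \<open>Only left multiplication by a single generator has been computed; associativity extends
  it to words.\<close>

lemma word_rel_append:
  assumes "u \<in> lists (gens n)" "v \<in> lists (gens n)"
  shows "word_rel n (u @ v) = mult_rel n (word_rel n u) (word_rel n v)"
  using assms(1)
proof induction
  case Nil
  then show ?case by (simp add: mult_rel_id_rel equiv_word_rel[OF assms(2)])
next
  case (Cons g w)
  have "g # w \<in> lists (gens n)" using Cons by auto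
  note eq = equiv_word_rel[OF assms(2)] equiv_word_rel[OF Cons.hyps(2)] equiv_id_rel
  have "word_rel n (g # w @ v) = mult_rel n (gen_act g (id_rel n)) (mult_rel n (word_rel n w) (word_rel n v))"
    using Cons eq by (simp add: mult_rel_gen_act equiv_mult_rel)
  also have "\<dots> = mult_rel n (mult_rel n (gen_act g (id_rel n)) (word_rel n w)) (word_rel n v)"
    by (rule mult_rel_assoc[symmetric])
      (use eq Cons.hyps equiv_gen_act equiv_type in blast)+
  finally show ?case using Cons eq by (simp add: mult_rel_gen_act)
qed

subsection \<open>The relations hold for diagrams\<close>

lemma cup_cap_transpose: "cup_cap u v (inv_image R (transpose u v)) = cup_cap u v R"
proof -
  have "(x, y) \<in> cup_cap u v (inv_image R (transpose u v)) \<longleftrightarrow> (x, y) \<in> cup_cap u v R" for x y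
    unfolding cup_cap_def by auto
  then show ?thesis by auto
qed

lemma inv_image_transpose_cup_cap:
  "inv_image (cup_cap u v R) (transpose u v) = cup_cap u v R"
proof -
  have "inv_image (cup_cap u v R) (transpose u v) = cup_cap v u (inv_image R (transpose u v))"
    using cup_cap_inv_image[OF inj_transpose, of v u R u v] by simp
  then show ?thesis
    by (simp only: cup_cap_swap[of v u] cup_cap_transpose)
qed

text \<open>By \<open>cup_cap_cup_cap\<close> the middle surgery may be traded for the transposition
  of \<open>u\<close> and \<open>w\<close>. Moved inwards, it turns the inner surgery into one at
  \<open>v, w\<close>; trading that one as well produces a second copy, and the two cancel.\<close>

lemma cup_cap_triple:
  fixes R :: "('a \<times> 'a) set"
  assumes "equiv A R" "distinct [u, v, w]" "{u, v, w} \<subseteq> A"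
  shows "cup_cap u v (cup_cap v w (cup_cap u v R)) = cup_cap u v R"
proof -
  let ?t = "transpose u w"
  have tv: "?t v = v"
    using assms(2) by (auto simp: transpose_def)
  have t: "?t x \<in> A \<longleftrightarrow> x \<in> A" for x
    using assms(3) by (auto simp: transpose_def)
  have "equiv A (cup_cap u v R)" "equiv A (inv_image R ?t)"
    using assms(3) equiv_inv_image[OF assms(1) t] by (auto intro: equiv_cup_cap[OF assms(1)])
  then have "cup_cap u v (cup_cap v w (cup_cap u v R)) = cup_cap u v (inv_image (cup_cap u v R) ?t)"
    using assms by (intro cup_cap_cup_cap) auto
  also have "inv_image (cup_cap u v R) ?t = cup_cap v w (inv_image R ?t)"
    using cup_cap_inv_image[OF inj_transpose, of v w R u w] tv by (simp add: cup_cap_swap)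
  also have "cup_cap u v \<dots> = cup_cap u v (inv_image (inv_image R ?t) ?t)"
    using assms \<open>equiv A (inv_image R ?t)\<close> by (intro cup_cap_cup_cap) auto
  finally show ?thesis by (simp add: inv_image_comp inv_image_def)
qed

lemma transpose_comp_transpose:
  assumes "distinct [u, v, w]"
  shows "transpose u v \<circ> transpose u w = transpose v w \<circ> transpose u v"
    "transpose u w \<circ> transpose u v = transpose u v \<circ> transpose v w"
  using assms by (auto simp: fun_eq_iff transpose_def)

text \<open>After the inner surgery is traded for the transposition of \<open>u\<close> and
  \<open>w\<close>, the product of the two transpositions is rewritten so that the one of
  \<open>u\<close> and \<open>v\<close> stands next to the outer surgery, which absorbs it.\<close>

lemma cup_cap_cup_cap_transpose:
  fixes R :: "('a \<times> 'a) set"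
  assumes "equiv A R" "distinct [u, v, w]" "{u, v, w} \<subseteq> A"
  shows "cup_cap u v (cup_cap v w (inv_image R (transpose u v)))
      = cup_cap u v (inv_image R (transpose v w))"
proof -
  have t: "transpose a b x \<in> A \<longleftrightarrow> x \<in> A" if "a \<in> A" "b \<in> A" for a b x
    using that by (auto simp: transpose_def)
  have eq: "equiv A (inv_image R (transpose u v))"
    using assms(3) by (auto intro!: equiv_inv_image[OF assms(1)] t)
  have "cup_cap u v (cup_cap v w (inv_image R (transpose u v)))
      = cup_cap u v (inv_image R (transpose u v \<circ> transpose u w))"
    unfolding inv_image_comp[symmetric] by (rule cup_cap_cup_cap[OF eq assms(2,3)])
  also have "\<dots> = cup_cap u v (inv_image (inv_image R (transpose v w)) (transpose u v))"
    unfolding transpose_comp_transpose(1)[OF assms(2)] inv_image_comp ..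
  also have "\<dots> = cup_cap u v (inv_image R (transpose v w))"
    by (rule cup_cap_transpose)
  finally show ?thesis .
qed

lemma transpose_cup_cap_cup_cap:
  fixes R :: "('a \<times> 'a) set"
  assumes "equiv A R" "distinct [u, v, w]" "{u, v, w} \<subseteq> A"
  shows "inv_image (cup_cap v w (cup_cap u v R)) (transpose u v)
      = inv_image (cup_cap u v R) (transpose v w)"
proof -
  have tv: "transpose u w v = v"
    using assms(2) by (auto simp: transpose_def)
  have "cup_cap v w (cup_cap u v R) = cup_cap w v (cup_cap v u R)"
    by (simp add: cup_cap_swap)
  also have "\<dots> = cup_cap w v (inv_image R (transpose w u))"
    using assms by (intro cup_cap_cup_cap) auto
  also have "\<dots> = inv_image (cup_cap u v R) (transpose u w)"
    using cup_cap_inv_image[OF inj_transpose, of w v R u w] tv by (simp add: transpose_commute)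
  finally have "inv_image (cup_cap v w (cup_cap u v R)) (transpose u v)
      = inv_image (inv_image (cup_cap u v R) (transpose u v)) (transpose v w)"
    unfolding inv_image_comp transpose_comp_transpose(2)[OF assms(2), symmetric]
    by (simp only: inv_image_comp)
  then show ?thesis
    by (simp only: inv_image_transpose_cup_cap)
qed

lemma map_left_transpose: "map_left (transpose a b) = transpose (Le a) (Le b)"
  by (rule ext, rename_tac x, case_tac x) (auto simp: transpose_def)

lemma adjacent_cases:
  assumes "adjacent i j"
  obtains "j = Suc i" | "i = Suc j"
  using assms that by linarith

lemma transpose_braid:
  "transpose i (Suc i) \<circ> transpose (Suc i) (Suc (Suc i)) \<circ> transpose i (Suc i)
    = transpose (Suc i) (Suc (Suc i)) \<circ> transpose i (Suc i) \<circ> transpose (Suc i) (Suc (Suc i))"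
  by (auto simp: fun_eq_iff transpose_def)

lemma gen_act_relations:
  assumes "(u, v) \<in> T_rels n" "equiv (points n) R"
  shows "foldr gen_act u R = foldr gen_act v R"
proof -
  \<comment> \<open>Adjacent indices occur in two orders. For the second the three points are read
    downwards, and \<open>swap\<close> restores the order inside each pair.\<close>
  have swap: "cup_cap (Le (Suc j)) (Le j) = cup_cap (Le j) (Le (Suc j))"
    "transpose (Le (Suc j)) (Le j) = transpose (Le j) (Le (Suc j))" for j
    by (intro ext cup_cap_swap) (rule transpose_commute)
  from assms(1) show ?thesis
  proof cases
    case (1 i)
    then show ?thesis by (simp add: inv_image_comp map_left_comp) (simp add: inv_image_def)
  next
    case (2 i j)
    then have "transpose j (Suc j) \<circ> transpose i (Suc i) = transpose i (Suc i) \<circ> transpose j (Suc j)"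
      by (auto simp: fun_eq_iff transpose_def)
    then show ?thesis using 2 by (simp add: inv_image_comp map_left_comp)
  next
    case (3 i j)
    from 3(5) have "transpose i (Suc i) \<circ> transpose j (Suc j) \<circ> transpose i (Suc i)
        = transpose j (Suc j) \<circ> transpose i (Suc i) \<circ> transpose j (Suc j)"
      by (cases rule: adjacent_cases) (simp_all add: transpose_braid)
    then show ?thesis using 3 by (simp add: inv_image_comp map_left_comp o_assoc)
  next
    case (4 i)
    then show ?thesis by (simp add: cup_cap_idem)
  next
    case (5 i j)
    then have "distinct [Le i, Le (Suc i), Le j, Le (Suc j)]"
      "{Le i, Le (Suc i), Le j, Le (Suc j)} \<subseteq> points n"
      by auto
    from cup_cap_commute[OF assms(2) this] show ?thesis by (simp add: 5)
  next
    case (6 i j)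
    from 6(5) show ?thesis
    proof (cases rule: adjacent_cases)
      case 1
      have "distinct [Le i, Le (Suc i), Le (Suc (Suc i))]"
        "{Le i, Le (Suc i), Le (Suc (Suc i))} \<subseteq> points n"
        using 1 6 by auto
      from cup_cap_triple[OF assms(2) this] show ?thesis by (simp add: 6 1)
    next
      case 2
      have "distinct [Le (Suc (Suc j)), Le (Suc j), Le j]"
        "{Le (Suc (Suc j)), Le (Suc j), Le j} \<subseteq> points n"
        using 2 6 by auto
      from cup_cap_triple[OF assms(2) this] show ?thesis by (simp add: 6 2 swap)
    qed
  next
    case (7 i)
    then show ?thesis by (simp add: map_left_transpose cup_cap_transpose)
  next
    case (8 i)
    then show ?thesis by (simp add: map_left_transpose inv_image_transpose_cup_cap)
  next
    case (9 i j)
    then have "transpose (Le j) (Le (Suc j)) (Le i) = Le i"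
      "transpose (Le j) (Le (Suc j)) (Le (Suc i)) = Le (Suc i)"
      by (auto simp: transpose_def)
    then show ?thesis using 9 by (simp add: map_left_transpose cup_cap_inv_image[OF inj_transpose])
  next
    case (10 i j)
    from 10(5) show ?thesis
    proof (cases rule: adjacent_cases)
      case 1
      have "distinct [Le i, Le (Suc i), Le (Suc (Suc i))]"
        "{Le i, Le (Suc i), Le (Suc (Suc i))} \<subseteq> points n"
        using 1 10 by auto
      from transpose_cup_cap_cup_cap[OF assms(2) this] show ?thesis
        by (simp add: 10 1 map_left_transpose)
    next
      case 2
      have "distinct [Le (Suc (Suc j)), Le (Suc j), Le j]"
        "{Le (Suc (Suc j)), Le (Suc j), Le j} \<subseteq> points n"
        using 2 10 by auto
      from transpose_cup_cap_cup_cap[OF assms(2) this] show ?thesis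
        by (simp add: 10 2 map_left_transpose swap)
    qed
  next
    case (11 i j)
    from 11(5) show ?thesis
    proof (cases rule: adjacent_cases)
      case 1
      have "distinct [Le i, Le (Suc i), Le (Suc (Suc i))]"
        "{Le i, Le (Suc i), Le (Suc (Suc i))} \<subseteq> points n"
        using 1 11 by auto
      from cup_cap_cup_cap_transpose[OF assms(2) this] show ?thesis
        by (simp add: 11 1 map_left_transpose)
    next
      case 2
      have "distinct [Le (Suc (Suc j)), Le (Suc j), Le j]"
        "{Le (Suc (Suc j)), Le (Suc j), Le j} \<subseteq> points n"
        using 2 11 by auto
      from cup_cap_cup_cap_transpose[OF assms(2) this] show ?thesis
        by (simp add: 11 2 map_left_transpose swap)
    qed
  qed
qed

lemma word_rel_cong:
  assumes "(u, v) \<in> pres_cong (gens n) (T_rels n)"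
  shows "word_rel n u = word_rel n v"
  using assms
proof induction
  case (rel u v)
  then show ?case using gen_act_relations[OF _ equiv_id_rel] unfolding word_rel_def by blast
next
  case (append u v u' v')
  have "u \<in> lists (gens n)" "u' \<in> lists (gens n)" "v \<in> lists (gens n)" "v' \<in> lists (gens n)"
    using append.hyps equiv_type[OF equiv_pres_cong] by blast+
  then show ?case using append.IH by (simp add: word_rel_append)
qed auto

subsection \<open>Brauer diagrams as a matching and a permutation\<close>

definition matching :: "nat \<Rightarrow> nat set set \<Rightarrow> bool" where
  "matching n P \<longleftrightarrow> (\<forall>e\<in>P. e \<subseteq> {1..n} \<and> card e = 2) \<and> disjoint P"

lemma matching_pair:
  assumes "matching n P" "{a, b} \<in> P"
  shows "a \<noteq> b" "a \<in> {1..n}" "b \<in> {1..n}"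
proof -
  have "card {a, b} = 2" "{a, b} \<subseteq> {1..n}"
    using assms unfolding matching_def by blast+
  then show "a \<noteq> b" "a \<in> {1..n}" "b \<in> {1..n}"
    by auto
qed

lemma matching_disjoint:
  assumes "matching n P" "e \<in> P" "e' \<in> P" "a \<in> e" "a \<in> e'"
  shows "e = e'"
  using assms unfolding matching_def disjoint_def by blast

lemma matching_obtain:
  assumes "matching n P" "a \<in> \<Union>P"
  obtains b where "{a, b} \<in> P"
proof -
  from assms(2) obtain e where e: "e \<in> P" "a \<in> e" by blast
  then have "card e = 2" using assms(1) unfolding matching_def by blast
  then obtain b where "e = {a, b}" using e(2) by (auto simp: card_2_iff)
  then show ?thesis using that e by blast
qed

lemma matching_unique:
  assumes "matching n P" "{a, b} \<in> P" "{a, c} \<in> P"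
  shows "b = c"
  using matching_disjoint[OF assms, of a] by (auto simp: doubleton_eq_iff)

lemma matching_image:
  assumes "matching n P" "p permutes {1..n}"
  shows "matching n ((`) p ` P)"
proof -
  have "inj p" using assms(2) by (rule permutes_inj)
  have "card (p ` e) = 2" if "e \<in> P" for e
    using that assms(1) card_image[OF inj_on_subset[OF \<open>inj p\<close> subset_UNIV], of e]
    unfolding matching_def by metis
  moreover have "p ` e \<subseteq> {1..n}" if "e \<in> P" for e
    using that assms(1) permutes_image[OF assms(2)] unfolding matching_def by (metis image_mono)
  moreover have "p ` e \<inter> p ` e' = {}" if "e \<in> P" "e' \<in> P" "p ` e \<noteq> p ` e'" for e e'
  proof -
    have "e \<inter> e' = {}"
      using that assms(1) unfolding matching_def disjoint_def by blast
    then show ?thesis using image_Int[OF \<open>inj p\<close>, of e e'] by simp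
  qed
  ultimately show ?thesis
    unfolding matching_def disjoint_def by blast
qed

lemma matching_insert:
  assumes "matching n P" "a \<in> {1..n}" "b \<in> {1..n}" "a \<noteq> b" "a \<notin> \<Union>P" "b \<notin> \<Union>P"
  shows "matching n (insert {a, b} P)"
  using assms unfolding matching_def disjoint_def by auto

fun joined :: "nat set set \<Rightarrow> (nat \<Rightarrow> nat) \<Rightarrow> point \<Rightarrow> point \<Rightarrow> bool" where
  "joined P p (Le a) (Le b) \<longleftrightarrow> a = b \<or> {a, b} \<in> P"
| "joined P p (Ri a) (Ri b) \<longleftrightarrow> a = b \<or> {p a, p b} \<in> P"
| "joined P p (Le a) (Ri b) \<longleftrightarrow> a = p b \<and> a \<notin> \<Union>P"
| "joined P p (Ri a) (Le b) \<longleftrightarrow> b = p a \<and> b \<notin> \<Union>P"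
| "joined P p _ _ \<longleftrightarrow> False"

text \<open>The left brackets are the pairs in \<^term>\<open>P\<close>, the right brackets their preimages under
  \<^term>\<open>p\<close>, and the lines join \<^term>\<open>p b\<close> to \<^term>\<open>b\<close>.\<close>

definition diagram_rel :: "nat \<Rightarrow> nat set set \<Rightarrow> (nat \<Rightarrow> nat) \<Rightarrow> (point \<times> point) set" where
  "diagram_rel n P p = {(x, y). x \<in> points n \<and> y \<in> points n \<and> joined P p x y}"

lemma diagram_rel_id: "diagram_rel n {} id = id_rel n"
proof -
  have "joined {} id x y \<longleftrightarrow> index x = index y" if "x \<in> points n" "y \<in> points n" for x y
    using that by (elim points_cases) auto
  then show ?thesis unfolding diagram_rel_def id_rel_def by blast
qed

lemma equiv_diagram_rel:
  assumes "matching n P" "p permutes {1..n}"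
  shows "equiv (points n) (diagram_rel n P p)"
proof -
  have u: "a = c" if "{a, b} \<in> P" "{b, c} \<in> P" for a b c
    using matching_unique[OF assms(1), of b a c] that by (simp add: insert_commute)
  note inj = inj_eq[OF permutes_inj[OF assms(2)]]
  have "joined P p x z" if "joined P p x y" "joined P p y z" for x y z
    using that by (cases x; cases y; cases z) (auto simp: inj dest: u)
  moreover have "joined P p y x" if "joined P p x y" for x y
    using that by (cases x; cases y) (auto simp: insert_commute)
  moreover have "joined P p x x" if "x \<in> points n" for x
    using that by (cases rule: points_cases) auto
  ultimately show ?thesis
    unfolding equiv_iff_refl_sym_trans diagram_rel_def by blast
qed

text \<open>Since lines join \<open>p b\<close> to \<open>b\<close>, relabelling the left points
  composes with \<open>p\<close> on the left, the order in which \<open>perm_act\<close> multiplies.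
  Inverse image and image agree because a transposition is an involution.\<close>

lemma inv_image_diagram_rel:
  assumes "a \<in> {1..n}" "b \<in> {1..n}"
  shows "inv_image (diagram_rel n P p) (map_left (transpose a b))
    = diagram_rel n ((`) (transpose a b) ` P) (transpose a b \<circ> p)"
proof -
  let ?t = "transpose a b"
  have t: "?t x \<in> {1..n} \<longleftrightarrow> x \<in> {1..n}" for x
    using assms by (auto simp: transpose_def)
  have im: "e \<in> (`) ?t ` P \<longleftrightarrow> ?t ` e \<in> P" for e
  proof -
    have tt: "?t ` ?t ` e' = e'" for e' by (simp add: image_image)
    show ?thesis
    proof
      assume "?t ` e \<in> P"
      then have "?t ` ?t ` e \<in> (`) ?t ` P" by (rule imageI)
      then show "e \<in> (`) ?t ` P" by (simp only: tt)
    qed (use tt in auto)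
  qed
  have Un: "x \<in> \<Union> ((`) ?t ` P) \<longleftrightarrow> ?t x \<in> \<Union>P" for x
    by (auto simp: image_iff) (metis transpose_involutory)+
  have inv: "?t x = y \<longleftrightarrow> x = ?t y" for x y by auto
  have "joined P p (map_left ?t x) (map_left ?t y) \<longleftrightarrow> joined ((`) ?t ` P) (?t \<circ> p) x y" for x y
    by (cases x; cases y) (auto simp: im Un inv simp del: Union_iff)
  then show ?thesis
    unfolding diagram_rel_def inv_image_def by (simp add: map_left_in_points[OF t])
qed

text \<open>The lines at \<open>a\<close> and \<open>b\<close> become one left and one right
  bracket. The right bracket consists of the preimages of \<open>a\<close> and \<open>b\<close>
  under \<open>p\<close>, so \<open>p\<close> need not change.\<close>

lemma cup_cap_diagram_rel:
  assumes "matching n P" "p permutes {1..n}" "a \<in> {1..n}" "b \<in> {1..n}" "a \<noteq> b" "a \<notin> \<Union>P" "b \<notin> \<Union>P"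
  shows "cup_cap (Le a) (Le b) (diagram_rel n P p) = diagram_rel n (insert {a, b} P) p"
proof -
  have nP: "{c, d} \<notin> P" "{d, c} \<notin> P" if "c \<in> {a, b}" for c d
    using that assms(6,7) by auto
  note inj = inj_eq[OF permutes_inj[OF assms(2)]]
  have in_n: "p c \<in> {1..n} \<longleftrightarrow> c \<in> {1..n}" for c by (rule permutes_in_image[OF assms(2)])
  have nU: "x \<in> \<Union> (insert {a, b} P) \<longleftrightarrow> x = a \<or> x = b \<or> x \<in> \<Union>P" for x by auto
  have "(x, y) \<in> cup_cap (Le a) (Le b) (diagram_rel n P p)
    \<longleftrightarrow> (x, y) \<in> diagram_rel n (insert {a, b} P) p" if "x \<in> points n" "y \<in> points n" for x y
  proof -
    note [simp] = cup_cap_def diagram_rel_def doubleton_eq_iff nU nP assms(5)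
    note [simp del] = Union_iff Union_insert
    from that(1) show ?thesis
    proof (cases rule: points_cases)
      case x: (Le c)
      from that(2) show ?thesis
        by (cases rule: points_cases) (use x assms(3-7) in auto)
    next
      case x: (Ri c)
      from that(2) show ?thesis
        by (cases rule: points_cases) (use x assms(3-7) in \<open>auto simp: inj\<close>)
    qed
  qed
  moreover have "cup_cap (Le a) (Le b) (diagram_rel n P p) \<subseteq> points n \<times> points n"
    using assms(3,4) by (intro equiv_type equiv_cup_cap equiv_diagram_rel assms(1,2)) auto
  moreover have "diagram_rel n (insert {a, b} P) p \<subseteq> points n \<times> points n"
    unfolding diagram_rel_def by auto
  ultimately show ?thesis by blast
qed

lemma cup_cap_diagram_rel_absorb:
  assumes "matching n P" "p permutes {1..n}" "{a, b} \<in> P"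
  shows "cup_cap (Le a) (Le b) (diagram_rel n P p) = diagram_rel n P p"
proof (rule cup_cap_absorb[OF equiv_diagram_rel[OF assms(1,2)]])
  note ab = matching_pair[OF assms(1,3)]
  have uniq: "{a, c} \<in> P \<longleftrightarrow> c = b" for c
    using assms(3) matching_unique[OF assms(1,3)] by metis
  have aU: "a \<in> \<Union>P" using assms(3) by blast
  have "(Le a, y) \<in> diagram_rel n P p \<longleftrightarrow> y \<in> {Le a, Le b}" for y
    using ab uniq aU by (cases y) (auto simp: diagram_rel_def simp del: Union_iff)
  then show "diagram_rel n P p `` {Le a} = {Le a, Le b}" by blast
qed

text \<open>Over \<open>\<Union>P\<close> the diagram records which points are paired but not the
  values of \<open>p\<close>; this remaining ambiguity is what
  \<open>brackets_act_stabiliser\<close> removes.\<close>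

lemma diagram_rel_eqD:
  assumes "diagram_rel n P p = diagram_rel n P' p'" "matching n P" "matching n P'"
    "p permutes {1..n}" "p' permutes {1..n}"
  shows "P = P'" "\<And>b. b \<in> {1..n} \<Longrightarrow> p b \<notin> \<Union>P \<Longrightarrow> p' b = p b"
    "\<And>a b. a \<in> {1..n} \<Longrightarrow> b \<in> {1..n} \<Longrightarrow> {p a, p b} \<in> P \<Longrightarrow> {p' a, p' b} \<in> P"
proof -
  have sub: "Q \<subseteq> Q'" if eq: "diagram_rel n Q q = diagram_rel n Q' q'" and Q: "matching n Q"
    for Q Q' q q'
  proof
    fix e assume e: "e \<in> Q"
    then obtain a b where ab: "e = {a, b}" using Q e unfolding matching_def
      by (meson card_2_iff)
    with e have "(Le a, Le b) \<in> diagram_rel n Q q" "a \<noteq> b"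
      using matching_pair[OF Q, of a b] by (auto simp: diagram_rel_def)
    then show "e \<in> Q'" unfolding eq ab by (simp add: diagram_rel_def)
  qed
  show PP: "P = P'" using sub[OF assms(1,2)] sub[OF assms(1)[symmetric] assms(3)] by blast
  show "p' b = p b" if "b \<in> {1..n}" "p b \<notin> \<Union>P" for b
  proof -
    have "(Le (p b), Ri b) \<in> diagram_rel n P p"
      using that permutes_in_image[OF assms(4), of b] by (simp add: diagram_rel_def del: Union_iff)
    then show ?thesis unfolding assms(1) by (simp add: diagram_rel_def)
  qed
  show "{p' a, p' b} \<in> P" if "a \<in> {1..n}" "b \<in> {1..n}" "{p a, p b} \<in> P" for a b
  proof -
    \<comment> \<open>Excludes that the two right points are joined merely by reflexivity.\<close>
    have "a \<noteq> b" using matching_pair(1)[OF assms(2) that(3)] by blast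
    have "(Ri a, Ri b) \<in> diagram_rel n P p" using that by (simp add: diagram_rel_def)
    then show ?thesis unfolding assms(1) using \<open>a \<noteq> b\<close> PP by (simp add: diagram_rel_def)
  qed
qed

lemma card_diagram_rel_class:
  assumes "matching n P" "p permutes {1..n}" "x \<in> points n"
  shows "card (diagram_rel n P p `` {x}) = 2"
proof -
  note inj = inj_eq[OF permutes_inj[OF assms(2)]]
  note u = matching_unique[OF assms(1)]
  have in_n: "p c \<in> {1..n} \<longleftrightarrow> c \<in> {1..n}" for c by (rule permutes_in_image[OF assms(2)])
  have surj: "\<exists>c. a = p c" for a using permutes_surj[OF assms(2)] by (rule surjD)
  have "\<exists>y. y \<noteq> x \<and> (\<forall>z. (x, z) \<in> diagram_rel n P p \<longleftrightarrow> z \<in> {x, y})"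
    using assms(3)
  proof (cases rule: points_cases)
    case (Le a)
    show ?thesis
    proof (cases "a \<in> \<Union>P")
      case True
      then obtain b where b: "{a, b} \<in> P" using matching_obtain[OF assms(1)] by blast
      note ab = matching_pair[OF assms(1) b]
      have "{a, c} \<in> P \<longleftrightarrow> c = b" for c using b u[OF b] by metis
      then have "(Le a, z) \<in> diagram_rel n P p \<longleftrightarrow> z \<in> {Le a, Le b}" for z
        using ab True by (cases z) (auto simp: diagram_rel_def simp del: Union_iff)
      then show ?thesis using ab Le by (intro exI[of _ "Le b"]) auto
    next
      case False
      then have nP: "{a, c} \<notin> P" for c by blast
      obtain c where c: "a = p c" using surj by blast
      have "(Le a, z) \<in> diagram_rel n P p \<longleftrightarrow> z \<in> {Le a, Ri c}" for z
        using Le c in_n[of c] False nP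
        by (cases z) (auto simp: diagram_rel_def inj simp del: Union_iff atLeastAtMost_iff)
      then show ?thesis using Le by (intro exI[of _ "Ri c"]) auto
    qed
  next
    case (Ri a)
    show ?thesis
    proof (cases "p a \<in> \<Union>P")
      case True
      then obtain b' where b': "{p a, b'} \<in> P" using matching_obtain[OF assms(1)] by blast
      obtain b where b: "b' = p b" using surj by blast
      note ab = matching_pair[OF assms(1) b'[unfolded b]]
      have "{p a, p c} \<in> P \<longleftrightarrow> c = b" for c using b b' u[OF b'] inj by metis
      then have "(Ri a, z) \<in> diagram_rel n P p \<longleftrightarrow> z \<in> {Ri a, Ri b}" for z
        using ab Ri in_n[of b] in_n[of a] True
        by (cases z) (auto simp: diagram_rel_def simp del: Union_iff atLeastAtMost_iff)
      then show ?thesis using ab Ri by (intro exI[of _ "Ri b"]) auto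
    next
      case False
      then have nP: "{p a, c} \<notin> P" for c by blast
      have "(Ri a, z) \<in> diagram_rel n P p \<longleftrightarrow> z \<in> {Ri a, Le (p a)}" for z
        using Ri in_n[of a] False nP
        by (cases z) (auto simp: diagram_rel_def simp del: Union_iff atLeastAtMost_iff)
      then show ?thesis using Ri by (intro exI[of _ "Le (p a)"]) auto
    qed
  qed
  then obtain y where "y \<noteq> x" "diagram_rel n P p `` {x} = {x, y}" by blast
  then show ?thesis by simp
qed

section \<open>The Coxeter presentation of the symmetric group\<close>

text \<open>With an arbitrary type acted upon, the coset argument serves twice: for the operators in
  question and, through the instance \<open>transpositions\<close>, for the permutations
  themselves.\<close>

locale coxeter_action =
  fixes n :: nat and s :: "nat \<Rightarrow> 'a \<Rightarrow> 'a"
  assumes involution: "i \<in> {1..<n} \<Longrightarrow> s i (s i x) = x"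
    and commute: "i \<in> {1..<n} \<Longrightarrow> j \<in> {1..<n} \<Longrightarrow> far i j \<Longrightarrow> s i (s j x) = s j (s i x)"
    and braid: "i \<in> {1..<n} \<Longrightarrow> Suc i \<in> {1..<n}
      \<Longrightarrow> s i (s (Suc i) (s i x)) = s (Suc i) (s i (s (Suc i) x))"
begin

lemma foldr_commute:
  assumes "j \<in> {1..<n}" "\<And>i. i \<in> set xs \<Longrightarrow> i \<in> {1..<n} \<and> far i j"
  shows "s j (foldr s xs x) = foldr s xs (s j x)"
  using assms(2)
proof (induction xs)
  case (Cons i xs)
  then have "s j (s i (foldr s xs x)) = s i (s j (foldr s xs x))"
    using commute[of j i] assms(1) by (metis abs_minus_commute list.set_intros(1))
  then show ?case using Cons by simp
qed simp

end

text \<open>The image of \<open>i\<close> under the transposition of \<open>j\<close> and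
  \<open>j + 1\<close>, that is, the coset reached from coset \<open>i\<close> under left
  multiplication by the letter \<open>j\<close>.\<close>

definition coset_index :: "nat \<Rightarrow> nat \<Rightarrow> nat" where
  "coset_index i j = (if Suc j = i then j else if j = i then Suc i else i)"

text \<open>What is left of the letter \<open>j\<close> after it has been pushed through
  \<open>[i..<m]\<close>: itself if it commutes with the word, lowered by one if it meets a braid,
  and nothing if it lengthens or shortens the word.\<close>

definition coset_rest :: "nat \<Rightarrow> nat \<Rightarrow> nat list" where
  "coset_rest i j = (if Suc j < i then [j] else if i < j then [j - 1] else [])"

lemma coset_bounds:
  assumes "i \<in> {1..m}" "j \<in> {1..<m}"
  shows "coset_index i j \<in> {1..m}" "set (coset_rest i j) \<subseteq> {1..<m - 1}"
  using assms by (auto simp: coset_index_def coset_rest_def)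

text \<open>The words \<open>[i..<m]\<close> represent the left cosets of \<open>S\<^sub>m\<^sub>-\<^sub>1\<close> in \<open>S\<^sub>m\<close>: such a word sends \<open>m\<close> to \<open>i\<close>.\<close>

lemma (in coxeter_action) coset_step:
  assumes "i \<in> {1..m}" "j \<in> {1..<m}" "m \<le> n"
  shows "s j (foldr s [i..<m] x) = foldr s [coset_index i j..<m] (foldr s (coset_rest i j) x)"
proof -
  consider "Suc j < i" | "Suc j = i" | "j = i" | "i < j" by linarith
  then show ?thesis
  proof cases
    case 1
    then have "s j (foldr s [i..<m] x) = foldr s [i..<m] (s j x)"
      using assms by (intro foldr_commute) auto
    then show ?thesis using 1 by (simp add: coset_index_def coset_rest_def)
  next
    case 2
    then show ?thesis using assms by (simp add: coset_index_def coset_rest_def upt_conv_Cons)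
  next
    case 3
    then show ?thesis
      using assms by (simp add: coset_index_def coset_rest_def upt_conv_Cons involution)
  next
    case 4
    then obtain k where k: "j = Suc k" "i \<le> k" by (cases j) auto
    let ?y = "foldr s [Suc j..<m] x"
    have split: "[i..<m] = [i..<k] @ [k, j] @ [Suc j..<m]"
    proof -
      have "[i..<m] = [i..<k] @ [k..<m]"
        using upt_add_eq_append[of i k "m - k"] k assms by auto
      then show ?thesis using k assms by (simp add: upt_conv_Cons)
    qed
    \<comment> \<open>The letter \<open>j\<close> commutes up to the pair \<open>k, j\<close>; the
      braid relation makes it emerge as \<open>k\<close>, which commutes with everything further
      right.\<close>
    have "s j (foldr s [i..<m] x) = foldr s [i..<k] (s j (s k (s j ?y)))"
      unfolding split foldr_append using k assms foldr_commute[of j "[i..<k]"] by simp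
    also have "s j (s k (s j ?y)) = s k (s j (s k ?y))"
      using braid[of k ?y] k assms by simp
    also have "s k ?y = foldr s [Suc j..<m] (s k x)"
      using k assms by (intro foldr_commute) auto
    finally show ?thesis
      using 4 k split by (simp add: coset_index_def coset_rest_def)
  qed
qed

section \<open>Permutations as words in adjacent transpositions\<close>

definition perm_word :: "nat list \<Rightarrow> nat \<Rightarrow> nat" where
  "perm_word xs = foldr (\<lambda>i. transpose i (Suc i)) xs"

lemma perm_word_simps [simp]:
  "perm_word [] = id" "perm_word (i # xs) = transpose i (Suc i) \<circ> perm_word xs"
  "perm_word (xs @ ys) = perm_word xs \<circ> perm_word ys"
  by (simp_all add: perm_word_def fun_eq_iff)

interpretation transpositions: coxeter_action n "\<lambda>i. transpose i (Suc i)"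
proof
  show "transpose i (Suc i) (transpose j (Suc j) x) = transpose j (Suc j) (transpose i (Suc i) x)"
    if "far i j" for i j x
    using that by (auto simp: transpose_def)
  show "transpose i (Suc i) (transpose (Suc i) (Suc (Suc i)) (transpose i (Suc i) x))
    = transpose (Suc i) (Suc (Suc i)) (transpose i (Suc i) (transpose (Suc i) (Suc (Suc i)) x))" for i x
    using transpose_braid[of i] by (simp add: fun_eq_iff)
qed simp

lemma perm_word_rev: "perm_word xs (perm_word (rev xs) k) = k" "perm_word (rev xs) (perm_word xs k) = k"
proof -
  have "perm_word xs (perm_word (rev xs) k) = k" for xs
    by (induction xs arbitrary: k) simp_all
  from this[of xs] this[of "rev xs"]
  show "perm_word xs (perm_word (rev xs) k) = k" "perm_word (rev xs) (perm_word xs k) = k"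
    by simp_all
qed

lemma perm_word_permutes:
  assumes "set xs \<subseteq> {1..<n}"
  shows "perm_word xs permutes {1..n}"
  using assms
proof (induction xs)
  case (Cons i xs)
  then have "transpose i (Suc i) permutes {1..n}" by (intro permutes_swap_id) auto
  moreover have "perm_word xs permutes {1..n}" using Cons by simp
  ultimately show ?case unfolding perm_word_simps by (rule permutes_compose[rotated])
qed (simp add: permutes_id)

lemma perm_word_upt:
  assumes "i \<le> m"
  shows "perm_word [i..<m] m = i"
  using assms
proof (induction rule: inc_induct)
  case (step k)
  then show ?case by (simp add: upt_conv_Cons)
qed simp

text \<open>The coset word of \<open>p (Suc m)\<close> sends \<open>Suc m\<close> where
  \<open>p\<close> does. Cancelling it from \<open>p\<close> on the left leaves a permutation that
  fixes \<open>Suc m\<close>, to which the induction hypothesis applies.\<close>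

lemma perm_word_surj:
  assumes "p permutes {1..m}"
  shows "\<exists>xs. set xs \<subseteq> {1..<m} \<and> perm_word xs = p"
  using assms
proof (induction m arbitrary: p)
  case 0
  then show ?case by (intro exI[of _ "[]"]) simp
next
  case (Suc m)
  define i where "i = p (Suc m)"
  let ?c = "[i..<Suc m]"
  have i: "i \<in> {1..Suc m}" unfolding i_def using permutes_in_image[OF Suc.prems, of "Suc m"] by simp
  then have "set (rev ?c) \<subseteq> {1..<Suc m}" by auto
  then have "perm_word (rev ?c) \<circ> p permutes {1..Suc m}"
    using Suc.prems perm_word_permutes permutes_compose by blast
  moreover have "(perm_word (rev ?c) \<circ> p) (Suc m) = Suc m"
    using perm_word_rev(2)[of ?c "Suc m"] perm_word_upt[of i "Suc m"] i by (simp add: i_def)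
  ultimately have "perm_word (rev ?c) \<circ> p permutes {1..m}"
    by (elim permutes_superset) (auto simp: le_Suc_eq)
  from Suc.IH[OF this] obtain u where u: "set u \<subseteq> {1..<m}" "perm_word u = perm_word (rev ?c) \<circ> p"
    by blast
  have "perm_word (?c @ u) = p"
    using perm_word_rev(1)[of ?c] u(2) by (simp add: fun_eq_iff del: upt_Suc)
  moreover have "set (?c @ u) \<subseteq> {1..<Suc m}"
    using i u(1) by auto
  ultimately show ?case by blast
qed

section \<open>Equal permutations give equal operators\<close>

context coxeter_action
begin

text \<open>Each letter is pushed through by \<open>coset_step\<close> in the action and among
  permutations at once, so the same \<open>i\<close> and \<open>ys\<close> serve for both.\<close>

lemma coset_form:
  assumes "set xs \<subseteq> {1..<m}" "1 \<le> m" "m \<le> n"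
  shows "\<exists>i ys. i \<in> {1..m} \<and> set ys \<subseteq> {1..<m - 1}
    \<and> (\<forall>x. foldr s xs x = foldr s [i..<m] (foldr s ys x))
    \<and> perm_word xs = perm_word [i..<m] \<circ> perm_word ys"
  using assms(1)
proof (induction xs)
  case Nil
  show ?case using assms(2) by (intro exI[of _ m] exI[of _ "[]"]) simp
next
  case (Cons j xs)
  then have "set xs \<subseteq> {1..<m}" by simp
  from Cons.IH[OF this] obtain i ys where iy: "i \<in> {1..m}" "set ys \<subseteq> {1..<m - 1}"
    "\<And>x. foldr s xs x = foldr s [i..<m] (foldr s ys x)"
    "perm_word xs = perm_word [i..<m] \<circ> perm_word ys"
    by blast
  have j: "j \<in> {1..<m}" using Cons.prems by simp
  let ?i = "coset_index i j" and ?ys = "coset_rest i j @ ys"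
  note b = coset_bounds[OF iy(1) j]
  have "foldr s (j # xs) x = foldr s [?i..<m] (foldr s ?ys x)" for x
    using coset_step[OF iy(1) j assms(3)] iy(3) by simp
  moreover have "perm_word (j # xs) = perm_word [?i..<m] \<circ> perm_word ?ys"
    using transpositions.coset_step[OF iy(1) j order_refl] iy(4)
    by (simp add: perm_word_def fun_eq_iff)
  ultimately show ?case using b iy(2) by (intro exI[of _ ?i] exI[of _ ?ys]) auto
qed

text \<open>The coset index of a word is the image of the largest point, so equal permutations give
  equal coset words. These cancel, and the remaining words involve one point fewer.\<close>

lemma foldr_eq_if_perm_word_eq:
  assumes "set xs \<subseteq> {1..<n}" "set ys \<subseteq> {1..<n}" "perm_word xs = perm_word ys"
  shows "foldr s xs x = foldr s ys x"
proof -
  have "foldr s xs x = foldr s ys x"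
    if "set xs \<subseteq> {1..<m}" "set ys \<subseteq> {1..<m}" "perm_word xs = perm_word ys" "m \<le> n" for m
    using that
  proof (induction m arbitrary: xs ys x)
    case (Suc m)
    have one: "1 \<le> Suc m" by simp
    obtain i u where u: "i \<in> {1..Suc m}" "set u \<subseteq> {1..<m}"
      "\<And>x. foldr s xs x = foldr s [i..<Suc m] (foldr s u x)"
      "perm_word xs = perm_word [i..<Suc m] \<circ> perm_word u"
      using coset_form[OF Suc.prems(1) one Suc.prems(4)] unfolding diff_Suc_1 by blast
    obtain j v where v: "j \<in> {1..Suc m}" "set v \<subseteq> {1..<m}"
      "\<And>x. foldr s ys x = foldr s [j..<Suc m] (foldr s v x)"
      "perm_word ys = perm_word [j..<Suc m] \<circ> perm_word v"
      using coset_form[OF Suc.prems(2) one Suc.prems(4)] unfolding diff_Suc_1 by blast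
    have fixed: "perm_word w (Suc m) = Suc m" if "set w \<subseteq> {1..<m}" for w
      using permutes_not_in[OF perm_word_permutes[OF that]] by simp
    have "perm_word xs (Suc m) = i"
      unfolding u(4) using u(1) fixed[OF u(2)] perm_word_upt[of i "Suc m"] by (simp del: upt_Suc)
    moreover have "perm_word ys (Suc m) = j"
      unfolding v(4) using v(1) fixed[OF v(2)] perm_word_upt[of j "Suc m"] by (simp del: upt_Suc)
    ultimately have "i = j" using Suc.prems(3) by simp
    then have "perm_word [i..<Suc m] (perm_word u k) = perm_word [i..<Suc m] (perm_word v k)" for k
      using fun_cong[OF Suc.prems(3), of k] \<open>i = j\<close> unfolding u(4) v(4) comp_apply by simp
    then have "perm_word u k = perm_word v k" for k
      using perm_word_rev(2)[of "[i..<Suc m]"] by metis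
    then have "perm_word u = perm_word v" by (rule ext)
    then have "foldr s u x = foldr s v x" for x
      using Suc.prems(4) by (intro Suc.IH[OF u(2) v(2)]) simp_all
    then show ?case unfolding u(3) v(3) \<open>i = j\<close> by simp
  qed simp
  then show ?thesis using assms by blast
qed

definition perm_act :: "(nat \<Rightarrow> nat) \<Rightarrow> 'a \<Rightarrow> 'a" where
  "perm_act p = foldr s (SOME xs. set xs \<subseteq> {1..<n} \<and> perm_word xs = p)"

lemma perm_act_perm_word:
  assumes "set xs \<subseteq> {1..<n}"
  shows "perm_act (perm_word xs) x = foldr s xs x"
proof -
  have "set (SOME ys. set ys \<subseteq> {1..<n} \<and> perm_word ys = perm_word xs) \<subseteq> {1..<n} \<and>
    perm_word (SOME ys. set ys \<subseteq> {1..<n} \<and> perm_word ys = perm_word xs) = perm_word xs"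
    by (rule someI[of _ xs]) (use assms in simp)
  then show ?thesis
    unfolding perm_act_def using assms by (intro foldr_eq_if_perm_word_eq) auto
qed

lemma perm_act_id [simp]: "perm_act id x = x"
  using perm_act_perm_word[of "[]"] by simp

lemma perm_act_transpose: "i \<in> {1..<n} \<Longrightarrow> perm_act (transpose i (Suc i)) x = s i x"
  using perm_act_perm_word[of "[i]"] by simp

lemma perm_act_comp:
  assumes "p permutes {1..n}" "q permutes {1..n}"
  shows "perm_act (p \<circ> q) x = perm_act p (perm_act q x)"
proof -
  obtain xs ys where "set xs \<subseteq> {1..<n}" "perm_word xs = p" "set ys \<subseteq> {1..<n}" "perm_word ys = q"
    using perm_word_surj assms by metis
  then show ?thesis
    using perm_act_perm_word[of "xs @ ys"] perm_act_perm_word[of xs] perm_act_perm_word[of ys]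
    by auto
qed

end

section \<open>Normal forms\<close>

text \<open>The symmetric group is transitive on tuples of distinct points. This carries identities
  between generators with fixed small indices over to arbitrary points by conjugation.\<close>

lemma permutes_extend:
  assumes "distinct xs" "distinct ys" "length xs = length ys" "set xs \<subseteq> A" "set ys \<subseteq> A"
  shows "\<exists>g. g permutes A \<and> map g xs = ys"
  using assms(3,1,2,4,5)
proof (induction xs ys rule: list_induct2)
  case Nil
  show ?case by (intro exI[of _ id] conjI permutes_id) simp
next
  case (Cons x xs y ys)
  from Cons.prems have "distinct xs" "distinct ys" "set xs \<subseteq> A" "set ys \<subseteq> A" by simp_all
  from Cons.IH[OF this] obtain g where g: "g permutes A" "map g xs = ys" by blast
  let ?t = "transpose (g x) y"
  have "g x \<in> A" using permutes_in_image[OF g(1)] Cons.prems(3) by simp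
  then have "?t permutes A" using Cons.prems(4) by (intro permutes_swap_id) auto
  then have p: "?t \<circ> g permutes A" using g(1) by (rule permutes_compose[rotated])
  have "?t (g z) = g z" if "z \<in> set xs" for z
  proof -
    have "g z \<in> set ys" using that unfolding g(2)[symmetric] by simp
    then have "g z \<noteq> y" using Cons.prems(2) by auto
    moreover have "g z \<noteq> g x"
      using that Cons.prems(1) inj_eq[OF permutes_inj[OF g(1)]] by auto
    ultimately show ?thesis by simp
  qed
  then have "map (?t \<circ> g) xs = map g xs" by simp
  then have "map (?t \<circ> g) (x # xs) = y # ys" using g(2) by simp
  with p show ?case by (intro exI[of _ "?t \<circ> g"] conjI)
qed

locale brauer_action =
  fixes n :: nat and act :: "gen \<Rightarrow> 'a \<Rightarrow> 'a"
  assumes relation: "(u, v) \<in> T_rels n \<Longrightarrow> foldr act u x = foldr act v x"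
begin

abbreviation s :: "nat \<Rightarrow> 'a \<Rightarrow> 'a" where "s i \<equiv> act (\<sigma> i)"
abbreviation t :: "nat \<Rightarrow> 'a \<Rightarrow> 'a" where "t i \<equiv> act (\<theta> i)"

lemma index_set: "{1..<n} = {1..n - 1}"
  by auto

sublocale coxeter_action n s
proof
  show "s i (s i x) = x" if "i \<in> {1..<n}" for i x
    using relation[OF T_rels.intros(1)[of i n], of x] that unfolding index_set by simp
  show "s i (s j x) = s j (s i x)" if "i \<in> {1..<n}" "j \<in> {1..<n}" "far i j" for i j x
    using relation[OF T_rels.intros(2)[of i n j], of x] that unfolding index_set by simp
  show "s i (s (Suc i) (s i x)) = s (Suc i) (s i (s (Suc i) x))"
    if "i \<in> {1..<n}" "Suc i \<in> {1..<n}" for i x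
    using relation[OF T_rels.intros(3)[of i n "Suc i"], of x] that unfolding index_set by simp
qed

lemma t_idem: "t i (t i x) = t i x" if "i \<in> {1..<n}"
  using relation[OF T_rels.intros(4)[of i n], of x] that unfolding index_set by simp

lemma t_commute: "t i (t j x) = t j (t i x)" if "i \<in> {1..<n}" "j \<in> {1..<n}" "far i j"
  using relation[OF T_rels.intros(5)[of i n j], of x] that unfolding index_set by simp

lemma t_s: "t i (s i x) = t i x" if "i \<in> {1..<n}"
  using relation[OF T_rels.intros(7)[of i n], of x] that unfolding index_set by simp

lemma s_t: "s i (t i x) = t i x" if "i \<in> {1..<n}"
  using relation[OF T_rels.intros(8)[of i n], of x] that unfolding index_set by simp

lemma t_s_commute: "t i (s j x) = s j (t i x)" if "i \<in> {1..<n}" "j \<in> {1..<n}" "far i j"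
  using relation[OF T_rels.intros(9)[of i n j], of x] that unfolding index_set by simp

lemma s_t_t: "s i (t j (t i x)) = s j (t i x)" if "i \<in> {1..<n}" "j \<in> {1..<n}" "adjacent i j"
  using relation[OF T_rels.intros(10)[of i n j], of x] that unfolding index_set by simp

lemma t_t_s: "t i (t j (s i x)) = t i (s j x)" if "i \<in> {1..<n}" "j \<in> {1..<n}" "adjacent i j"
  using relation[OF T_rels.intros(11)[of i n j], of x] that unfolding index_set by simp

text \<open>The mixed relations \<open>s_t_t\<close> and \<open>t_t_s\<close> make neighbouring
  \<open>t i\<close> and \<open>t j\<close> conjugate, so that a single one of them determines all
  the others.\<close>

lemma t_conjugate:
  assumes "i \<in> {1..<n}" "j \<in> {1..<n}" "adjacent i j"
  shows "t j x = s i (s j (t i (s j (s i x))))"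
proof -
  have ji: "adjacent j i" using assms(3) by simp
  have "s j (t i (s j (s i x))) = s i (t j (t i (s j (s i x))))"
    using s_t_t[OF assms] by simp
  also have "\<dots> = s i (t j (s i (s i x)))"
    using t_t_s[OF assms(2,1) ji] by simp
  finally show ?thesis using assms(1) involution by simp
qed

section \<open>Bracket operators for arbitrary pairs\<close>

lemma perm_act_inv:
  assumes "p permutes {1..n}"
  shows "perm_act p (perm_act (inv_into UNIV p) x) = x" "perm_act (inv_into UNIV p) (perm_act p x) = x"
  using perm_act_comp[OF assms permutes_inv[OF assms], of x]
    perm_act_comp[OF permutes_inv[OF assms] assms, of x] permutes_inv_o[OF assms]
  by simp_all

text \<open>A permutation fixing both points is a word in letters below \<open>n - 2\<close>, each
  far from \<open>n - 1\<close> and hence commuting with \<open>t (n - 1)\<close>. If the two points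
  are exchanged, the extra factor \<open>s (n - 1)\<close> is absorbed on either side.\<close>

lemma perm_act_t_base:
  assumes "p permutes {1..n}" "p ` {n - 1, n} = {n - 1, n}" "2 \<le> n"
  shows "perm_act p (t (n - 1) x) = t (n - 1) (perm_act p x)"
proof -
  have m: "n - 1 \<in> {1..<n}" "Suc (n - 1) = n" using assms(3) by auto
  have *: "perm_act q (t (n - 1) x) = t (n - 1) (perm_act q x)"
    if q: "q permutes {1..n}" "q (n - 1) = n - 1" "q n = n" for q x
  proof -
    have "q permutes {1..n - 2}"
    proof (rule permutes_superset[OF q(1)])
      fix j assume "j \<in> {1..n} - {1..n - 2}"
      then have "j = n - 1 \<or> j = n" by auto
      then show "q j = j" using q by auto
    qed
    then obtain xs where xs: "set xs \<subseteq> {1..<n - 2}" "perm_word xs = q"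
      using perm_word_surj by blast
    have sub: "set xs \<subseteq> {1..<n}" using xs(1) by (rule order_trans) auto
    have "foldr s xs (t (n - 1) x) = t (n - 1) (foldr s xs x)"
      using xs(1) m(1)
    proof (induction xs)
      case (Cons i xs)
      then have "far (n - 1) i" "i \<in> {1..<n}" by auto
      then show ?case using Cons t_s_commute[of "n - 1" i] by simp
    qed simp
    then show ?thesis using perm_act_perm_word[OF sub] xs(2) by simp
  qed
  have "p (n - 1) \<noteq> p n"
    using injD[OF permutes_inj[OF assms(1)], of "n - 1" n] m by auto
  moreover have "p (n - 1) \<in> {n - 1, n}" "p n \<in> {n - 1, n}"
    using assms(2) by blast+
  ultimately consider "p (n - 1) = n - 1" "p n = n" | "p (n - 1) = n" "p n = n - 1"
    by auto
  then show ?thesis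
  proof cases
    case 1
    then show ?thesis using * assms(1) by blast
  next
    case 2
    let ?t = "transpose (n - 1) (Suc (n - 1))"
    have tp: "?t permutes {1..n}" using m by (intro permutes_swap_id) auto
    have q: "?t \<circ> p permutes {1..n}" using permutes_compose[OF assms(1) tp] .
    have "p = ?t \<circ> (?t \<circ> p)" by (simp add: fun_eq_iff)
    then have p: "perm_act p y = s (n - 1) (perm_act (?t \<circ> p) y)" for y
      using perm_act_comp[OF tp q] perm_act_transpose[OF m(1)] by metis
    have "perm_act (?t \<circ> p) (t (n - 1) x) = t (n - 1) (perm_act (?t \<circ> p) x)"
      using 2 m by (intro *[OF q]) simp_all
    then show ?thesis unfolding p using s_t[OF m(1)] t_s[OF m(1)] by simp
  qed
qed

text \<open>Indexing by the set, not by two points, builds in the symmetry of a bracket in its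
  ends.\<close>

definition bracket_act :: "nat set \<Rightarrow> 'a \<Rightarrow> 'a" where
  "bracket_act e x = (let g = SOME g. g permutes {1..n} \<and> g ` {n - 1, n} = e
     in perm_act g (t (n - 1) (perm_act (inv_into UNIV g) x)))"

text \<open>Two permutations taking \<open>{n - 1, n}\<close> to \<open>e\<close> differ by an
  element of the stabiliser of \<open>{n - 1, n}\<close>, which passes through
  \<open>t (n - 1)\<close> by \<open>perm_act_t_base\<close> and cancels.\<close>

lemma bracket_act_eq:
  assumes "g permutes {1..n}" "2 \<le> n" "g ` {n - 1, n} = e"
  shows "bracket_act e x = perm_act g (t (n - 1) (perm_act (inv_into UNIV g) x))"
proof -
  define h where "h = (SOME h. h permutes {1..n} \<and> h ` {n - 1, n} = e)"
  have h: "h permutes {1..n}" "h ` {n - 1, n} = e"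
    using someI[of "\<lambda>h. h permutes {1..n} \<and> h ` {n - 1, n} = e" g] assms
    unfolding h_def by blast+
  define k where "k = inv_into UNIV h \<circ> g"
  have k: "k permutes {1..n}"
    unfolding k_def by (rule permutes_compose[OF assms(1) permutes_inv[OF h(1)]])
  have "k ` {n - 1, n} = inv_into UNIV h ` h ` {n - 1, n}"
    unfolding k_def image_comp[symmetric] assms(3) h(2) ..
  then have kb: "k ` {n - 1, n} = {n - 1, n}"
    by (simp add: image_image permutes_inverses(2)[OF h(1)])
  have g: "g = h \<circ> k" "k \<circ> inv_into UNIV g = inv_into UNIV h"
    unfolding k_def by (simp_all add: fun_eq_iff permutes_inverses[OF h(1)] permutes_inverses[OF assms(1)])
  have "perm_act g (t (n - 1) (perm_act (inv_into UNIV g) x))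
      = perm_act h (t (n - 1) (perm_act k (perm_act (inv_into UNIV g) x)))"
    by (subst g(1)) (simp only: perm_act_comp[OF h(1) k] perm_act_t_base[OF k kb assms(2)])
  also have "\<dots> = perm_act h (t (n - 1) (perm_act (inv_into UNIV h) x))"
    by (simp only: perm_act_comp[OF k permutes_inv[OF assms(1)], symmetric] g(2))
  finally show ?thesis
    unfolding bracket_act_def h_def[symmetric] Let_def by simp
qed

lemma ex_perm_base:
  assumes "a \<in> {1..n}" "b \<in> {1..n}" "a \<noteq> b"
  shows "2 \<le> n" "\<exists>g. g permutes {1..n} \<and> g ` {n - 1, n} = {a, b}"
proof -
  show n: "2 \<le> n" using assms by auto
  have "\<exists>g. g permutes {1..n} \<and> map g [n - 1, n] = [a, b]"
    using assms n by (intro permutes_extend) auto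
  then show "\<exists>g. g permutes {1..n} \<and> g ` {n - 1, n} = {a, b}" by auto
qed

lemma perm_act_bracket_act:
  assumes "p permutes {1..n}" "a \<in> {1..n}" "b \<in> {1..n}" "a \<noteq> b"
  shows "perm_act p (bracket_act {a, b} x) = bracket_act {p a, p b} (perm_act p x)"
proof -
  note n = ex_perm_base(1)[OF assms(2-4)]
  obtain g where g: "g permutes {1..n}" "g ` {n - 1, n} = {a, b}"
    using ex_perm_base(2)[OF assms(2-4)] by blast
  have pg: "p \<circ> g permutes {1..n}" using permutes_compose[OF g(1) assms(1)] .
  have "(p \<circ> g) ` {n - 1, n} = {p a, p b}"
    unfolding image_comp[symmetric] g(2) by simp
  then have "bracket_act {p a, p b} (perm_act p x)
      = perm_act (p \<circ> g) (t (n - 1) (perm_act (inv_into UNIV (p \<circ> g)) (perm_act p x)))"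
    by (rule bracket_act_eq[OF pg n])
  also have "inv_into UNIV (p \<circ> g) = inv_into UNIV g \<circ> inv_into UNIV p"
    using permutes_bij[OF assms(1)] permutes_bij[OF g(1)] by (intro o_inv_distrib)
  finally show ?thesis
    by (simp only: bracket_act_eq[OF g(1) n g(2)] perm_act_comp[OF assms(1) g(1)]
        perm_act_comp[OF permutes_inv[OF g(1)] permutes_inv[OF assms(1)]] perm_act_inv[OF assms(1)])
qed

text \<open>Downward induction from the base pair: the conjugation that turns
  \<open>t (Suc k)\<close> into \<open>t k\<close> in \<open>t_conjugate\<close> also moves the pair
  \<open>{Suc k, Suc (Suc k)}\<close> to \<open>{k, Suc k}\<close>.\<close>

lemma bracket_act_adjacent:
  assumes "i \<in> {1..<n}"
  shows "bracket_act {i, Suc i} x = t i x"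
proof -
  have n: "2 \<le> n" using assms by auto
  have "i \<le> n - 1" "1 \<le> i" using assms by auto
  then show ?thesis
  proof (induction arbitrary: x rule: inc_induct)
    case base
    have inv_id: "inv_into UNIV id = id" by (rule inv_id)
    have "bracket_act {n - 1, Suc (n - 1)} x = perm_act id (t (n - 1) (perm_act (inv_into UNIV id) x))"
      using n by (intro bracket_act_eq permutes_id) auto
    then show ?case by (simp only: inv_id perm_act_id)
  next
    case (step k)
    have k: "k \<in> {1..<n}" "Suc k \<in> {1..<n}" "adjacent (Suc k) k" using step by auto
    have tr: "transpose k (Suc k) permutes {1..n}" "transpose (Suc k) (Suc (Suc k)) permutes {1..n}"
      using k by (intro permutes_swap_id; auto)+
    have "t k x = s (Suc k) (s k (t (Suc k) (s k (s (Suc k) x))))"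
      using t_conjugate[OF k(2,1,3)] .
    also have "\<dots> = s (Suc k) (s k (bracket_act {Suc k, Suc (Suc k)} (s k (s (Suc k) x))))"
      using step.IH by simp
    also have "s k (bracket_act {Suc k, Suc (Suc k)} y) = bracket_act {k, Suc (Suc k)} (s k y)" for y
      using perm_act_bracket_act[OF tr(1), of "Suc k" "Suc (Suc k)" y] k
      by (simp add: perm_act_transpose)
    also have "s (Suc k) (bracket_act {k, Suc (Suc k)} y) = bracket_act {k, Suc k} (s (Suc k) y)" for y
      using perm_act_bracket_act[OF tr(2), of k "Suc (Suc k)" y] k
      by (simp add: perm_act_transpose)
    finally show ?case using k involution by simp
  qed
qed

lemma bracket_act_idem:
  assumes "a \<in> {1..n}" "b \<in> {1..n}" "a \<noteq> b"
  shows "bracket_act {a, b} (bracket_act {a, b} x) = bracket_act {a, b} x"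
proof -
  note n = ex_perm_base(1)[OF assms]
  obtain g where g: "g permutes {1..n}" "g ` {n - 1, n} = {a, b}"
    using ex_perm_base(2)[OF assms] by blast
  have "n - 1 \<in> {1..<n}" using n by auto
  then show ?thesis
    by (simp add: bracket_act_eq[OF g(1) n g(2)] perm_act_inv[OF g(1)] t_idem)
qed

lemma bracket_act_transpose:
  assumes "a \<in> {1..n}" "b \<in> {1..n}" "a \<noteq> b"
  shows "bracket_act {a, b} (perm_act (transpose a b) x) = bracket_act {a, b} x"
proof -
  have n: "1 \<in> {1..<n}" using assms by auto
  have "\<exists>g. g permutes {1..n} \<and> map g [1, 2] = [a, b]"
    using assms by (intro permutes_extend) auto
  then obtain g where g: "g permutes {1..n}" "g 1 = a" "g 2 = b" by auto
  let ?y = "perm_act (inv_into UNIV g) x"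
  have x: "x = perm_act g ?y" using perm_act_inv(1)[OF g(1)] by simp
  have tr: "transpose a b permutes {1..n}" "transpose 1 (Suc 1) permutes {1..n}"
    using assms n by (intro permutes_swap_id; auto)+
  have "transpose a b \<circ> g = g \<circ> transpose 1 (Suc 1)"
    using g inj_eq[OF permutes_inj[OF g(1)]] by (auto simp: fun_eq_iff transpose_def numeral_2_eq_2)
  then have "perm_act (transpose a b) x = perm_act g (s 1 ?y)"
    using x perm_act_comp[OF tr(1) g(1)] perm_act_comp[OF g(1) tr(2)] perm_act_transpose[OF n] by metis
  moreover have "bracket_act {a, b} (perm_act g y) = perm_act g (t 1 y)" for y
    using perm_act_bracket_act[OF g(1), of 1 2 y] bracket_act_adjacent[OF n] n g(2,3)
    by (simp add: numeral_2_eq_2)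
  ultimately show ?thesis using x t_s[OF n] by metis
qed

text \<open>Transported to the points 1, 2, 3 the claim reads
  \<open>t 1 (t 2 y) = t 1 (s 1 (s 2 (s 1 y)))\<close>: the first \<open>s 1\<close> is absorbed,
  and \<open>t_t_s\<close> together with the involution turns the rest into
  \<open>t 2\<close>.\<close>

lemma bracket_act_bracket_act:
  assumes "{a, b, c} \<subseteq> {1..n}" "distinct [a, b, c]"
  shows "bracket_act {a, b} (bracket_act {b, c} x) = bracket_act {a, b} (perm_act (transpose a c) x)"
proof -
  have "card {a, b, c} \<le> card {1..n}" using assms(1) by (intro card_mono) auto
  then have n: "1 \<in> {1..<n}" "2 \<in> {1..<n}" using assms(2) by auto
  have "\<exists>g. g permutes {1..n} \<and> map g [1, 2, 3] = [a, b, c]"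
    using assms n by (intro permutes_extend) auto
  then obtain g where g: "g permutes {1..n}" "g 1 = a" "g 2 = b" "g 3 = c" by auto
  let ?y = "perm_act (inv_into UNIV g) x"
  have x: "x = perm_act g ?y" using perm_act_inv(1)[OF g(1)] by simp
  have tr: "transpose a c permutes {1..n}" "transpose 1 3 permutes {1..n}"
    using assms n by (intro permutes_swap_id; auto)+
  have "transpose 1 3 = perm_word [1, 2, 1]"
    by (auto simp: fun_eq_iff transpose_def numeral_2_eq_2 numeral_3_eq_3)
  then have tr13: "perm_act (transpose 1 3) z = s 1 (s 2 (s 1 z))" for z
    using perm_act_perm_word[of "[1, 2, 1]" z] n by simp
  have "transpose a c \<circ> g = g \<circ> transpose 1 3"
    using g inj_eq[OF permutes_inj[OF g(1)]] by (auto simp: fun_eq_iff transpose_def)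
  then have px: "perm_act (transpose a c) x = perm_act g (s 1 (s 2 (s 1 ?y)))"
    using x perm_act_comp[OF tr(1) g(1)] perm_act_comp[OF g(1) tr(2)] tr13 by metis
  have ab: "bracket_act {a, b} (perm_act g z) = perm_act g (t 1 z)" for z
    using perm_act_bracket_act[OF g(1), of 1 2 z] bracket_act_adjacent[OF n(1)] n g
    by (simp add: numeral_2_eq_2)
  have bc: "bracket_act {b, c} (perm_act g z) = perm_act g (t 2 z)" for z
    using perm_act_bracket_act[OF g(1), of 2 3 z] bracket_act_adjacent[OF n(2)] n g
    by (simp add: numeral_2_eq_2 numeral_3_eq_3)
  have "t 1 (s 1 (s 2 (s 1 ?y))) = t 1 (s 2 (s 1 ?y))"
    by (rule t_s[OF n(1)])
  also have "\<dots> = t 1 (t 2 (s 1 (s 1 ?y)))"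
    using t_t_s[OF n] by simp
  also have "\<dots> = t 1 (t 2 ?y)"
    using involution[OF n(1)] by simp
  finally have "bracket_act {a, b} (perm_act (transpose a c) x) = perm_act g (t 1 (t 2 ?y))"
    unfolding px ab by simp
  also have "\<dots> = bracket_act {a, b} (bracket_act {b, c} (perm_act g ?y))"
    unfolding bc ab ..
  finally show ?thesis using x by simp
qed

lemma bracket_act_commute:
  assumes "{a, b, c, d} \<subseteq> {1..n}" "distinct [a, b, c, d]"
  shows "bracket_act {a, b} (bracket_act {c, d} x) = bracket_act {c, d} (bracket_act {a, b} x)"
proof -
  have "card {a, b, c, d} \<le> card {1..n}" using assms(1) by (intro card_mono) auto
  then have n: "1 \<in> {1..<n}" "3 \<in> {1..<n}" "far 1 3" using assms(2) by auto
  have "\<exists>g. g permutes {1..n} \<and> map g [1, 2, 3, 4] = [a, b, c, d]"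
    using assms n by (intro permutes_extend) auto
  then obtain g where g: "g permutes {1..n}" "g 1 = a" "g 2 = b" "g 3 = c" "g 4 = d" by auto
  let ?y = "perm_act (inv_into UNIV g) x"
  have x: "x = perm_act g ?y" using perm_act_inv(1)[OF g(1)] by simp
  have ab: "bracket_act {a, b} (perm_act g z) = perm_act g (t 1 z)" for z
    using perm_act_bracket_act[OF g(1), of 1 2 z] bracket_act_adjacent[OF n(1)] n g
    by (simp add: numeral_2_eq_2)
  have cd: "bracket_act {c, d} (perm_act g z) = perm_act g (t 3 z)" for z
    using perm_act_bracket_act[OF g(1), of 3 4 z] bracket_act_adjacent[OF n(2)] n g
    by (simp add: numeral_3_eq_3 numeral_eq_Suc)
  have "bracket_act {a, b} (bracket_act {c, d} (perm_act g ?y))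
      = bracket_act {c, d} (bracket_act {a, b} (perm_act g ?y))"
    unfolding ab cd t_commute[OF n] ..
  then show ?thesis using x by simp
qed

text \<open>Let A, B, C be the brackets at \<open>{a, b}\<close>, \<open>{b, c}\<close>,
  \<open>{c, d}\<close>. The two transpositions under A amount to B C by two uses of
  \<open>bracket_act_bracket_act\<close>. Applying C in front and moving it past A gives A C B C,
  and C B C = C.\<close>

lemma bracket_act_double_transpose:
  assumes "{a, b, c, d} \<subseteq> {1..n}" "distinct [a, b, c, d]"
  shows "bracket_act {a, b} (bracket_act {c, d} (perm_act (transpose a c) (perm_act (transpose b d) x)))
    = bracket_act {a, b} (bracket_act {c, d} x)"
proof -
  let ?A = "bracket_act {a, b}" and ?B = "bracket_act {b, c}" and ?C = "bracket_act {c, d}"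
  let ?x' = "perm_act (transpose a c) (perm_act (transpose b d) x)"
  have trp: "transpose d b permutes {1..n}" using assms by (intro permutes_swap_id) auto
  have BC: "?B (?C z) = ?B (perm_act (transpose b d) z)" for z
    using assms by (intro bracket_act_bracket_act) auto
  have CB: "?C (?B z) = ?C (perm_act (transpose d b) z)" for z
    using bracket_act_bracket_act[of d c b z] assms by (auto simp: insert_commute)
  have "?C (?B (?C x)) = ?C (perm_act (transpose d b) (?C x))"
    by (rule CB)
  also have "perm_act (transpose d b) (?C x) = ?B (perm_act (transpose d b) x)"
    using perm_act_bracket_act[OF trp, of c d x] assms by (auto simp: insert_commute)
  also have "?C \<dots> = ?C (perm_act (transpose d b) (perm_act (transpose d b) x))"
    by (rule CB)
  also have "\<dots> = ?C x"
    using perm_act_comp[OF trp trp, of x] by simp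
  finally have CBC: "?C (?B (?C x)) = ?C x" .
  have "?A (?B (?C x)) = ?A ?x'"
    unfolding BC using assms by (intro bracket_act_bracket_act) auto
  then have "?C (?A ?x') = ?C (?A (?B (?C x)))" by simp
  also have "\<dots> = ?A (?C (?B (?C x)))"
    using bracket_act_commute[OF assms] by simp
  finally show ?thesis using CBC bracket_act_commute[OF assms] by simp
qed

section \<open>Products of brackets over a matching\<close>

abbreviation brackets_act :: "nat set list \<Rightarrow> 'a \<Rightarrow> 'a" where
  "brackets_act es \<equiv> foldr bracket_act es"

lemma matching_obtain_pair:
  assumes "matching n P" "e \<in> P"
  obtains a b where "e = {a, b}" "a \<noteq> b" "a \<in> {1..n}" "b \<in> {1..n}"
proof -
  have "card e = 2" "e \<subseteq> {1..n}" using assms unfolding matching_def by blast+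
  then show ?thesis using that by (auto simp: card_2_iff)
qed

lemma bracket_act_commute_matching:
  assumes "matching n P" "e \<in> P" "e' \<in> P"
  shows "bracket_act e (bracket_act e' x) = bracket_act e' (bracket_act e x)"
proof (cases "e = e'")
  case False
  obtain a b where ab: "e = {a, b}" "a \<noteq> b" "a \<in> {1..n}" "b \<in> {1..n}"
    using matching_obtain_pair[OF assms(1,2)] .
  obtain c d where cd: "e' = {c, d}" "c \<noteq> d" "c \<in> {1..n}" "d \<in> {1..n}"
    using matching_obtain_pair[OF assms(1,3)] .
  have "e \<inter> e' = {}"
    using False assms unfolding matching_def disjoint_def by blast
  then show ?thesis
    unfolding ab(1) cd(1) using ab cd by (intro bracket_act_commute) auto
qed simp

lemma bracket_act_idem_matching:
  assumes "matching n P" "e \<in> P"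
  shows "bracket_act e (bracket_act e x) = bracket_act e x"
  using matching_obtain_pair[OF assms] bracket_act_idem by metis

lemma matching_subset: "matching n P \<Longrightarrow> Q \<subseteq> P \<Longrightarrow> matching n Q"
  unfolding matching_def disjoint_def by blast

lemma bracket_act_brackets_act_commute:
  assumes "matching n (insert e (set es))"
  shows "bracket_act e (brackets_act es x) = brackets_act es (bracket_act e x)"
  using assms
proof (induction es)
  case (Cons e' es)
  have "matching n (insert e (set es))"
    using Cons.prems by (rule matching_subset) auto
  moreover have "bracket_act e (bracket_act e' y) = bracket_act e' (bracket_act e y)" for y
    by (rule bracket_act_commute_matching[OF Cons.prems]) auto
  ultimately show ?case using Cons.IH by simp
qed simp

lemma bracket_act_absorb:
  assumes "matching n (set es)" "e \<in> set es"
  shows "bracket_act e (brackets_act es x) = brackets_act es x"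
  using assms
proof (induction es)
  case (Cons e' es)
  have m: "matching n (set es)"
    using Cons.prems(1) by (rule matching_subset) auto
  show ?case
  proof (cases "e = e'")
    case True
    then show ?thesis using bracket_act_idem_matching[OF Cons.prems] by simp
  next
    case False
    then have "e \<in> set es" using Cons.prems(2) by simp
    moreover have "bracket_act e (bracket_act e' y) = bracket_act e' (bracket_act e y)" for y
      using Cons.prems by (intro bracket_act_commute_matching[OF Cons.prems(1)]) auto
    ultimately show ?thesis using Cons.IH[OF m] by simp
  qed
qed simp

lemma brackets_act_absorb:
  assumes "matching n (set es)" "e \<in> set es"
  shows "brackets_act es (bracket_act e x) = brackets_act es x"
  using bracket_act_absorb[OF assms, of x] bracket_act_brackets_act_commute[of e es x] assms
  by (simp add: insert_absorb)

text \<open>The lists may differ in order and in repetitions. When \<open>es'\<close> is applied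
  after \<open>es\<close>, each list absorbs the other, so the composite equals both sides.\<close>

lemma brackets_act_cong:
  assumes "matching n (set es)" "set es = set es'"
  shows "brackets_act es x = brackets_act es' x"
proof -
  have 1: "brackets_act fs (brackets_act es x) = brackets_act es x" if "set fs \<subseteq> set es" for fs
    using that by (induction fs) (simp_all add: bracket_act_absorb[OF assms(1)])
  have m: "matching n (set es')" using assms by simp
  have 2: "brackets_act es' (brackets_act fs x) = brackets_act es' x" if "set fs \<subseteq> set es'" for fs
    using that by (induction fs) (simp_all add: brackets_act_absorb[OF m])
  show ?thesis using 1[of es'] 2[of es] assms(2) by simp
qed

lemma perm_act_brackets_act:
  assumes "p permutes {1..n}" "matching n (set es)"
  shows "perm_act p (brackets_act es x) = brackets_act (map ((`) p) es) (perm_act p x)"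
  using assms(2)
proof (induction es)
  case (Cons e es)
  obtain a b where ab: "e = {a, b}" "a \<noteq> b" "a \<in> {1..n}" "b \<in> {1..n}"
    using matching_obtain_pair[OF Cons.prems] by auto
  have "matching n (set es)"
    using Cons.prems by (rule matching_subset) auto
  with Cons.IH show ?case
    using perm_act_bracket_act[OF assms(1) ab(3,4,2)] by (simp add: ab(1))
qed simp

text \<open>The same \<open>es\<close> and \<open>p\<close> describe the operator and the diagram of
  the word. This simultaneous description is what allows equality of diagrams to be turned into
  equality of operators.\<close>

lemma normal_form:
  assumes "w \<in> lists (gens n)"
  shows "\<exists>es p. matching n (set es) \<and> p permutes {1..n}
    \<and> (\<forall>x. foldr act w x = brackets_act es (perm_act p x))
    \<and> word_rel n w = diagram_rel n (set es) p"
  using assms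
proof induction
  case Nil
  have "matching n (set [])" by (simp add: matching_def disjoint_def)
  moreover have "foldr act [] x = brackets_act [] (perm_act id x)" for x
    unfolding perm_act_id by simp
  moreover have "word_rel n [] = diagram_rel n (set []) id"
    unfolding word_rel_simps list.set diagram_rel_id ..
  ultimately show ?case using permutes_id by blast
next
  case (Cons g w)
  then obtain es p where nf: "matching n (set es)" "p permutes {1..n}"
    "\<And>x. foldr act w x = brackets_act es (perm_act p x)"
    "word_rel n w = diagram_rel n (set es) p"
    by blast
  let ?P = "set es" and ?D = "diagram_rel n (set es) p"
  \<comment> \<open>Shared by the letters \<sigma> and by those \<theta> that act like a
    transposition on the current normal form.\<close>
  have permuted: ?case
    if ab: "a \<in> {1..n}" "b \<in> {1..n}"
      and act: "\<And>x. act g (brackets_act es x) = perm_act (transpose a b) (brackets_act es x)"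
      and rel: "gen_act g ?D = inv_image ?D (map_left (transpose a b))" for a b
  proof -
    let ?t = "transpose a b"
    have t: "?t permutes {1..n}" using ab by (rule permutes_swap_id)
    have "matching n (set (map ((`) ?t) es))"
      using matching_image[OF nf(1) t] by simp
    moreover have "?t \<circ> p permutes {1..n}" by (rule permutes_compose[OF nf(2) t])
    moreover have "foldr act (g # w) x = brackets_act (map ((`) ?t) es) (perm_act (?t \<circ> p) x)" for x
      by (simp add: nf(3) act perm_act_brackets_act[OF t nf(1)] perm_act_comp[OF t nf(2)])
    moreover have "word_rel n (g # w) = diagram_rel n (set (map ((`) ?t) es)) (?t \<circ> p)"
      by (simp add: nf(4) rel inv_image_diagram_rel[OF ab])
    ultimately show ?thesis by blast
  qed
  from Cons.hyps(1) show ?case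
  proof (cases rule: gens_cases)
    case (s i)
    then have "i \<in> {1..<n}" by auto
    then show ?thesis
      using s by (intro permuted[of i "Suc i"]) (simp_all add: perm_act_transpose)
  next
    case (t i)
    then have i: "i \<in> {1..<n}" "i \<in> {1..n}" "Suc i \<in> {1..n}" by auto
    have act_g: "act g x = bracket_act {i, Suc i} x" for x
      using bracket_act_adjacent[OF i(1)] t by simp
    have rel_g: "gen_act g R = cup_cap (Le i) (Le (Suc i)) R" for R
      using t by simp
    \<comment> \<open>A new bracket is added if both points are free and absorbed if it is already
      present. If a point is bracketed with some other point, the letter acts as a
      transposition.\<close>
    consider (free) "i \<notin> \<Union>?P" "Suc i \<notin> \<Union>?P" | (mem) "{i, Suc i} \<in> ?P"
      | (half) "{i, Suc i} \<notin> ?P" "i \<in> \<Union>?P \<or> Suc i \<in> \<Union>?P" by blast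
    then show ?thesis
    proof cases
      case free
      have "matching n (set ({i, Suc i} # es))"
        using matching_insert[OF nf(1) i(2,3) _ free] by simp
      moreover have "word_rel n (g # w) = diagram_rel n (set ({i, Suc i} # es)) p"
        using cup_cap_diagram_rel[OF nf(1,2) i(2,3) _ free] by (simp add: rel_g nf(4))
      moreover have "foldr act (g # w) x = brackets_act ({i, Suc i} # es) (perm_act p x)" for x
        by (simp add: act_g nf(3))
      ultimately show ?thesis using nf(2) by blast
    next
      case mem
      have "word_rel n (g # w) = diagram_rel n (set es) p"
        using cup_cap_diagram_rel_absorb[OF nf(1,2) mem] by (simp add: rel_g nf(4))
      moreover have "foldr act (g # w) x = brackets_act es (perm_act p x)" for x
        using bracket_act_absorb[OF nf(1) mem] by (simp add: act_g nf(3))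
      ultimately show ?thesis using nf(1,2) by blast
    next
      case half
      \<comment> \<open>\<open>c\<close> is one of the two points that has a bracket, and
        \<open>d\<close> is the other one, bracketed or not. The partner \<open>a\<close> of
        \<open>c\<close> then gives the transposition of \<open>d\<close> and
        \<open>a\<close>.\<close>
      obtain c d where cd: "{i, Suc i} = {d, c}" "c \<in> \<Union>?P" "c \<noteq> d"
      proof (cases "i \<in> \<Union>?P")
        case True
        then show ?thesis using that[of "Suc i" i] by (simp add: insert_commute)
      next
        case False
        then show ?thesis using half(2) that[of i "Suc i"] by simp
      qed
      obtain a where a: "{c, a} \<in> ?P" using matching_obtain[OF nf(1) cd(2)] by blast
      note ca = matching_pair[OF nf(1) a]
      have "a \<noteq> d" using half(1) a cd(1) by (auto simp: insert_commute)
      have d: "d \<in> {1..n}" using cd(1) i by (auto simp: doubleton_eq_iff)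
      have dca: "{d, c, a} \<subseteq> {1..n}" "distinct [d, c, a]"
        using ca d cd(3) \<open>a \<noteq> d\<close> by auto
      have tr: "transpose d a permutes {1..n}" using d ca by (intro permutes_swap_id)
      show ?thesis
      proof (rule permuted[of d a])
        fix x
        let ?y = "brackets_act es x"
        have "act g ?y = bracket_act {d, c} (bracket_act {c, a} ?y)"
          using bracket_act_absorb[OF nf(1) a] by (simp add: act_g cd(1))
        also have "\<dots> = bracket_act {d, c} (perm_act (transpose d a) ?y)"
          by (rule bracket_act_bracket_act[OF dca])
        also have "\<dots> = perm_act (transpose d a) (bracket_act {c, a} ?y)"
          using perm_act_bracket_act[OF tr ca(2,3,1)] dca(2) by (simp add: insert_commute)
        finally show "act g ?y = perm_act (transpose d a) ?y"
          using bracket_act_absorb[OF nf(1) a] by simp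
      next
        \<comment> \<open>The computation for the operators is repeated with surgeries: the bracket
          \<open>{c, a}\<close> of the diagram is duplicated and then traded for a
          transposition.\<close>
        let ?f = "transpose (Le d) (Le a)"
        have D: "?D = cup_cap (Le c) (Le a) ?D"
          using cup_cap_diagram_rel_absorb[OF nf(1,2) a] by simp
        have swap: "cup_cap (Le i) (Le (Suc i)) R = cup_cap (Le d) (Le c) R" for R
        proof -
          have "i = d \<and> Suc i = c \<or> i = c \<and> Suc i = d"
            using cd(1) unfolding doubleton_eq_iff .
          then show ?thesis
            by (elim disjE conjE) (simp_all add: cup_cap_swap[of "Le d"])
        qed
        have "gen_act g ?D = cup_cap (Le d) (Le c) (cup_cap (Le c) (Le a) ?D)"
          unfolding rel_g swap D[symmetric] ..
        also have "\<dots> = cup_cap (Le d) (Le c) (inv_image ?D ?f)"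
          using dca by (intro cup_cap_cup_cap[OF equiv_diagram_rel[OF nf(1,2)]]) auto
        also have "\<dots> = inv_image (cup_cap (?f (Le d)) (?f (Le c)) ?D) ?f"
          by (rule cup_cap_inv_image[OF inj_transpose])
        also have "cup_cap (?f (Le d)) (?f (Le c)) ?D = ?D"
        proof -
          have "?f (Le d) = Le a" "?f (Le c) = Le c"
            using dca(2) by (auto simp: transpose_def)
          then show ?thesis using D cup_cap_swap by metis
        qed
        finally show "gen_act g ?D = inv_image ?D (map_left (transpose d a))"
          by (simp add: map_left_transpose)
      qed (use d ca in auto)
    qed
  qed
qed

text \<open>Induction on the number of moved points. If \<open>k\<close> moves \<open>a\<close>, it
  maps the bracket \<open>{a, b}\<close> to a bracket \<open>{c, d}\<close>. Composing with the
  transposition of \<open>a\<close> and \<open>b\<close>, or with the double transposition when the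
  brackets differ, makes \<open>a\<close> fixed and moves no point that \<open>k\<close>
  fixes.\<close>

lemma brackets_act_stabiliser:
  assumes "matching n (set es)" "k permutes {1..n}" "\<And>x. x \<notin> \<Union> (set es) \<Longrightarrow> k x = x"
    "\<And>e. e \<in> set es \<Longrightarrow> k ` e \<in> set es"
  shows "brackets_act es (perm_act k x) = brackets_act es x"
  using assms(2-4)
proof (induction "card {x. k x \<noteq> x}" arbitrary: k x rule: less_induct)
  case less
  let ?P = "set es"
  note m = assms(1)
  have fin: "finite {x. k x \<noteq> x}"
  proof (rule finite_subset)
    show "{x. k x \<noteq> x} \<subseteq> {1..n}" using permutes_not_in[OF less.prems(1)] by blast
  qed simp
  have inj: "k x = k y \<longleftrightarrow> x = y" for x y
    using permutes_inj[OF less.prems(1)] by (rule inj_eq)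
  have reduce: ?case
    if \<tau>: "\<tau> permutes {1..n}" "\<And>x. \<tau> (\<tau> x) = x" "\<And>x. x \<notin> \<Union>?P \<Longrightarrow> \<tau> x = x"
        "\<And>e. e \<in> ?P \<Longrightarrow> \<tau> ` e \<in> ?P"
      and a: "k a \<noteq> a" "\<tau> (k a) = a" "\<And>x. k x = x \<Longrightarrow> \<tau> x = x"
      and act: "\<And>y. brackets_act es (perm_act \<tau> y) = brackets_act es y" for \<tau> a
  proof -
    let ?k = "\<tau> \<circ> k"
    have k: "?k permutes {1..n}" by (rule permutes_compose[OF less.prems(1) \<tau>(1)])
    have "a \<in> {x. k x \<noteq> x}" "a \<notin> {x. ?k x \<noteq> x}" "?k x \<noteq> x \<Longrightarrow> k x \<noteq> x" for x
      using a by (simp, simp, metis comp_apply)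
    then have "{x. ?k x \<noteq> x} \<subset> {x. k x \<noteq> x}" by blast
    then have smaller: "card {x. ?k x \<noteq> x} < card {x. k x \<noteq> x}"
      by (rule psubset_card_mono[OF fin])
    have fixed: "?k x = x" if "x \<notin> \<Union>?P" for x
      using less.prems(2)[OF that] \<tau>(3)[OF that] by simp
    have "?k ` e \<in> ?P" if "e \<in> ?P" for e
      unfolding image_comp[symmetric] by (intro \<tau>(4) less.prems(3) that)
    from less.hyps[OF smaller k fixed this]
    have "brackets_act es (perm_act ?k x) = brackets_act es x" .
    moreover have "\<tau> \<circ> ?k = k" using \<tau>(2) by (simp add: fun_eq_iff)
    then have "perm_act k x = perm_act \<tau> (perm_act ?k x)"
      using perm_act_comp[OF \<tau>(1) k, of x] by simp
    ultimately show ?thesis by (simp add: act)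
  qed
  show ?case
  proof (cases "k = id")
    case False
    then obtain a where a: "k a \<noteq> a" by (auto simp: fun_eq_iff)
    then obtain b where ab: "{a, b} \<in> ?P" using matching_obtain[OF m] less.prems(2) by metis
    note ab' = matching_pair[OF m ab]
    define c d where "c = k a" and "d = k b"
    have cd: "{c, d} \<in> ?P" using less.prems(3)[OF ab] by (simp add: c_def d_def)
    note cd' = matching_pair[OF m cd]
    show ?thesis
    proof (cases "c = b")
      case True
      then have "d = a" using matching_unique[OF m, of b a d] ab cd by (simp add: insert_commute)
      let ?\<tau> = "transpose a b"
      show ?thesis
      proof (rule reduce[of ?\<tau> a])
        show "?\<tau> permutes {1..n}" using ab' by (intro permutes_swap_id)
        show "?\<tau> x = x" if "x \<notin> \<Union>?P" for x using that ab by (auto simp: transpose_def)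
        show "?\<tau> ` e \<in> ?P" if "e \<in> ?P" for e
        proof (cases "a \<in> e \<or> b \<in> e")
          case True
          then have "e = {a, b}" using matching_disjoint[OF m that ab] by auto
          then show ?thesis using ab by (simp add: insert_commute)
        qed (use that in simp)
        show "?\<tau> (k a) = a" using True by (simp add: c_def)
        show "?\<tau> x = x" if "k x = x" for x
          using that True \<open>d = a\<close> ab'(1) by (auto simp: transpose_def c_def d_def)
        show "brackets_act es (perm_act ?\<tau> y) = brackets_act es y" for y
          using brackets_act_absorb[OF m ab] bracket_act_transpose[OF ab'(2,3,1)] by metis
      qed (use a in simp_all)
    next
      case False
      have "c \<noteq> a" using a by (simp add: c_def)
      have "d \<noteq> a" using False matching_unique[OF m, of a b c] ab cd by (auto simp: insert_commute)
      have "d \<noteq> b" using \<open>c \<noteq> a\<close> matching_unique[OF m, of b a c] ab cd by (auto simp: insert_commute)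
      have dist: "distinct [a, b, c, d]"
        using ab' cd' False \<open>c \<noteq> a\<close> \<open>d \<noteq> a\<close> \<open>d \<noteq> b\<close> by auto
      have sub: "{a, b, c, d} \<subseteq> {1..n}" using ab' cd' by auto
      let ?\<tau> = "transpose a c \<circ> transpose b d"
      have tr: "transpose a c permutes {1..n}" "transpose b d permutes {1..n}"
        using sub by (auto intro: permutes_swap_id)
      show ?thesis
      proof (rule reduce[of ?\<tau> a])
        show "?\<tau> permutes {1..n}" by (rule permutes_compose[OF tr(2,1)])
        show "?\<tau> (?\<tau> x) = x" for x using dist by (auto simp: transpose_def)
        show "?\<tau> x = x" if "x \<notin> \<Union>?P" for x using that ab cd by (auto simp: transpose_def)
        show "?\<tau> ` e \<in> ?P" if e: "e \<in> ?P" for e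
        proof -
          consider "e = {a, b}" | "e = {c, d}" | "e \<inter> {a, b, c, d} = {}"
            using matching_disjoint[OF m e ab] matching_disjoint[OF m e cd] by blast
          then show ?thesis
          proof cases
            case 1
            then have "?\<tau> ` e = {c, d}" using dist by (auto simp: transpose_def)
            then show ?thesis using cd by simp
          next
            case 2
            then have "?\<tau> ` e = {a, b}" using dist by (auto simp: transpose_def)
            then show ?thesis using ab by simp
          next
            case 3
            then have "?\<tau> z = z" if "z \<in> e" for z using that by (auto simp: transpose_def)
            then have "?\<tau> ` e = e" by simp
            then show ?thesis using e by simp
          qed
        qed
        show "?\<tau> (k a) = a" using dist by (simp add: c_def[symmetric])
        show "?\<tau> x = x" if "k x = x" for x
        proof -
          \<comment> \<open>All four points are moved by \<open>k\<close>: for instance,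
            \<open>k c = c\<close> and \<open>k a = c\<close> would give
            \<open>c = a\<close>.\<close>
          have "x \<noteq> a" "x \<noteq> b" "x \<noteq> c" "x \<noteq> d"
            using that dist inj c_def d_def by auto
          then show ?thesis by simp
        qed
        show "brackets_act es (perm_act ?\<tau> y) = brackets_act es y" for y
          using brackets_act_absorb[OF m ab] brackets_act_absorb[OF m cd]
            bracket_act_double_transpose[OF sub dist] perm_act_comp[OF tr] by metis
      qed (rule a)
    qed
  qed simp
qed

text \<open>Both normal forms have the same matching, and the quotient \<open>k\<close> of their
  permutations fixes all points outside it and permutes its pairs, so the brackets absorb
  \<open>k\<close>.\<close>

lemma foldr_act_eq_if_word_rel_eq:
  assumes "w \<in> lists (gens n)" "w' \<in> lists (gens n)" "word_rel n w = word_rel n w'"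
  shows "foldr act w x = foldr act w' x"
proof -
  obtain es p where nf: "matching n (set es)" "p permutes {1..n}"
    "\<And>x. foldr act w x = brackets_act es (perm_act p x)" "word_rel n w = diagram_rel n (set es) p"
    using normal_form[OF assms(1)] by blast
  obtain es' p' where nf': "matching n (set es')" "p' permutes {1..n}"
    "\<And>x. foldr act w' x = brackets_act es' (perm_act p' x)" "word_rel n w' = diagram_rel n (set es') p'"
    using normal_form[OF assms(2)] by blast
  have eq: "diagram_rel n (set es) p = diagram_rel n (set es') p'"
    using assms(3) nf(4) nf'(4) by simp
  note D = diagram_rel_eqD[OF eq nf(1) nf'(1) nf(2) nf'(2)]
  define k where "k = p' \<circ> inv_into UNIV p"
  have k: "k permutes {1..n}"
    unfolding k_def by (rule permutes_compose[OF permutes_inv[OF nf(2)] nf'(2)])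
  have kp: "k (p z) = p' z" for z
    unfolding k_def by (simp add: permutes_inverses[OF nf(2)])
  have surj: "\<exists>z. y = p z" for y
    using permutes_surj[OF nf(2)] by (rule surjD)
  have "k y = y" if "y \<notin> \<Union> (set es)" for y
  proof (cases "y \<in> {1..n}")
    case True
    obtain z where z: "y = p z" using surj by blast
    then have "z \<in> {1..n}" using True permutes_in_image[OF nf(2), of z] by simp
    then show ?thesis using D(2) that kp z by simp
  next
    case False
    then show ?thesis using permutes_not_in[OF k] by blast
  qed
  moreover have "k ` e \<in> set es" if e: "e \<in> set es" for e
  proof -
    obtain y z where yz: "e = {y, z}" "y \<noteq> z" "y \<in> {1..n}" "z \<in> {1..n}"
      using matching_obtain_pair[OF nf(1) e] .
    obtain u v where uv: "y = p u" "z = p v" using surj by blast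
    then have "u \<in> {1..n}" "v \<in> {1..n}" using yz permutes_in_image[OF nf(2)] by blast+
    then show ?thesis using D(3)[of u v] e yz uv by (simp add: kp)
  qed
  ultimately have "brackets_act es (perm_act k (perm_act p x)) = brackets_act es (perm_act p x)"
    by (intro brackets_act_stabiliser[OF nf(1) k])
  moreover have "k \<circ> p = p'" using kp by (simp add: fun_eq_iff)
  then have "perm_act k (perm_act p x) = perm_act p' x"
    using perm_act_comp[OF k nf(2), of x] by simp
  ultimately show ?thesis
    using brackets_act_cong[OF nf(1) D(1)] nf(3) nf'(3) by simp
qed

end

section \<open>Every Brauer diagram is a product of generators\<close>

lemma class_unique:
  assumes "card (R `` {x}) = 2" "(x, x) \<in> R" "(x, y) \<in> R" "(x, z) \<in> R" "y \<noteq> x" "z \<noteq> x"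
  shows "y = z"
proof -
  have "card (R `` {x} - {x}) = 1" using assms(1,2) by simp
  then obtain v where "R `` {x} - {x} = {v}" by (auto simp: card_1_singleton_iff)
  moreover have "y \<in> R `` {x} - {x}" "z \<in> R `` {x} - {x}" using assms(3-6) by auto
  ultimately show ?thesis by simp
qed

lemma class_partner:
  assumes "card (R `` {x}) = 2" "(x, x) \<in> R"
  obtains y where "(x, y) \<in> R" "y \<noteq> x"
proof -
  have "card (R `` {x} - {x}) = 1" using assms by simp
  then obtain v where "R `` {x} - {x} = {v}" by (auto simp: card_1_singleton_iff)
  then show ?thesis using that by blast
qed

definition reachable :: "nat \<Rightarrow> (point \<times> point) set \<Rightarrow> bool" where
  "reachable n R \<longleftrightarrow> (\<exists>w\<in>lists (gens n). word_rel n w = R)"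

lemma reachable_id_rel: "reachable n (id_rel n)"
  unfolding reachable_def by (intro bexI[of _ "[]"]) simp_all

lemma reachable_gen_act:
  assumes "reachable n R" "g \<in> gens n"
  shows "reachable n (gen_act g R)"
proof -
  obtain w where "w \<in> lists (gens n)" "word_rel n w = R"
    using assms(1) unfolding reachable_def by blast
  then show ?thesis
    unfolding reachable_def using assms(2) by (intro bexI[of _ "g # w"]) auto
qed

text \<open>Inverse images compose in reverse order: the first letter of the word acts on
  \<open>R\<close> first, and so \<open>R\<close> has to vary in the induction.\<close>

lemma reachable_map_left:
  assumes "reachable n R" "p permutes {1..n}"
  shows "reachable n (inv_image R (map_left p))"
proof -
  obtain xs where xs: "set xs \<subseteq> {1..<n}" "perm_word xs = p"
    using perm_word_surj[OF assms(2)] by blast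
  have "reachable n (inv_image R (map_left (perm_word xs)))"
    using xs(1) assms(1)
  proof (induction xs arbitrary: R)
    case (Cons i xs)
    have "\<sigma> i \<in> gens n" using Cons.prems(1) by (auto simp: gens_def)
    then have "reachable n (inv_image R (map_left (transpose i (Suc i))))"
      using reachable_gen_act[OF Cons.prems(2)] by fastforce
    with Cons have "reachable n (inv_image (inv_image R (map_left (transpose i (Suc i))))
        (map_left (perm_word xs)))"
      by auto
    then show ?case by (simp only: inv_image_comp map_left_comp perm_word_simps)
  qed (simp add: inv_image_def)
  then show ?thesis unfolding xs(2) .
qed

text \<open>The generator \<theta> with index 1 is conjugated by a permutation taking 1 and 2 to
  \<open>a\<close> and \<open>b\<close>.\<close>

lemma reachable_cup_cap:
  assumes "reachable n R" "a \<in> {1..n}" "b \<in> {1..n}" "a \<noteq> b"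
  shows "reachable n (cup_cap (Le a) (Le b) R)"
proof -
  have "\<exists>p. p permutes {1..n} \<and> map p [1, 2] = [a, b]"
    using assms(2-4) by (intro permutes_extend) auto
  then obtain p where p: "p permutes {1..n}" "p 1 = a" "p (Suc 1) = b"
    by (auto simp: numeral_2_eq_2)
  let ?f = "map_left p"
  have "\<theta> 1 \<in> gens n" using assms(2-4) by (auto simp: gens_def)
  from reachable_gen_act[OF reachable_map_left[OF assms(1) p(1)] this]
  have "reachable n (cup_cap (Le 1) (Le (Suc 1)) (inv_image R ?f))"
    by (simp only: gen_act.simps)
  also have "cup_cap (Le 1) (Le (Suc 1)) (inv_image R ?f) = inv_image (cup_cap (Le a) (Le b) R) ?f"
    using cup_cap_inv_image[OF inj_map_left[OF permutes_inj[OF p(1)]], of "Le 1" "Le (Suc 1)" R] p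
    by simp
  finally have "reachable n (inv_image (inv_image (cup_cap (Le a) (Le b) R) ?f)
      (map_left (inv_into UNIV p)))"
    by (rule reachable_map_left[OF _ permutes_inv[OF p(1)]])
  then show ?thesis
    by (simp add: inv_image_comp map_left_comp permutes_inv_o[OF p(1)]) (simp add: inv_image_def)
qed

definition left_ends :: "(point \<times> point) set \<Rightarrow> nat set" where
  "left_ends R = {i. \<exists>j. j \<noteq> i \<and> (Le i, Le j) \<in> R}"

text \<open>Every left point lies on a line. The lines define an injection of \<open>{1..n}\<close>
  into itself, hence a bijection, which uses up all right points and leaves none for a right
  bracket.\<close>

lemma reachable_no_left_ends:
  assumes R: "equiv (points n) R" "\<And>x. x \<in> points n \<Longrightarrow> card (R `` {x}) = 2" "left_ends R = {}"
  shows "reachable n R"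
proof -
  have refl: "(x, x) \<in> R" if "x \<in> points n" for x
    using that R(1) unfolding equiv_iff_refl_sym_trans by blast
  have sym: "(y, x) \<in> R" if "(x, y) \<in> R" for x y
    using that R(1) unfolding equiv_iff_refl_sym_trans by blast
  have trans: "(x, z) \<in> R" if "(x, y) \<in> R" "(y, z) \<in> R" for x y z
    using that R(1) unfolding equiv_iff_refl_sym_trans by blast
  have in_points: "y \<in> points n" if "(x, y) \<in> R" for x y
    using that equiv_type[OF R(1)] by blast
  have LL: "i = j" if "(Le i, Le j) \<in> R" for i j
  proof (rule ccontr)
    assume "i \<noteq> j"
    with that have "i \<in> left_ends R" unfolding left_ends_def by auto
    with R(3) show False by simp
  qed
  have "\<exists>j. j \<in> {1..n} \<and> (Le i, Ri j) \<in> R" if "i \<in> {1..n}" for i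
  proof -
    have x: "Le i \<in> points n" using that by simp
    obtain y where y: "(Le i, y) \<in> R" "y \<noteq> Le i"
      by (rule class_partner[OF R(2)[OF x] refl[OF x]])
    from y(1) have "y \<in> points n" by (rule in_points)
    then show ?thesis
    proof (cases rule: points_cases)
      case (Le k)
      then show ?thesis using y LL[of i k] by simp
    next
      case (Ri j)
      then show ?thesis using y(1) by blast
    qed
  qed
  then obtain q where q: "\<And>i. i \<in> {1..n} \<Longrightarrow> q i \<in> {1..n} \<and> (Le i, Ri (q i)) \<in> R"
    by metis
  \<comment> \<open>The identity outside \<open>{1..n}\<close> makes the map a permutation of the
    whole type.\<close>
  define p where "p i = (if i \<in> {1..n} then q i else i)" for i
  have p: "p i \<in> {1..n}" "(Le i, Ri (p i)) \<in> R" if "i \<in> {1..n}" for i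
    using q[OF that] that by (simp_all add: p_def)
  have inj: "inj_on p {1..n}"
  proof (rule inj_onI)
    fix i j assume ij: "i \<in> {1..n}" "j \<in> {1..n}" "p i = p j"
    have "(Le i, Ri (p j)) \<in> R" using p(2)[OF ij(1)] ij(3) by simp
    moreover have "(Ri (p j), Le j) \<in> R" using p(2)[OF ij(2)] by (rule sym)
    ultimately have "(Le i, Le j) \<in> R" by (rule trans)
    then show "i = j" by (rule LL)
  qed
  then have surj: "p ` {1..n} = {1..n}"
    using p(1) by (intro endo_inj_surj[OF finite_atLeastAtMost image_subsetI])
  have "p permutes {1..n}"
  proof (rule bij_imp_permutes)
    show "bij_betw p {1..n} {1..n}" using inj surj unfolding bij_betw_def by blast
    show "p x = x" if "x \<notin> {1..n}" for x using that unfolding p_def by (rule if_not_P)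
  qed
  have LR: "(Le i, Ri j) \<in> R \<longleftrightarrow> j = p i" if i: "i \<in> {1..n}" for i j
  proof
    assume h: "(Le i, Ri j) \<in> R"
    have P: "Le i \<in> points n" using i by simp
    have "Ri j = Ri (p i)"
      by (rule class_unique[OF R(2)[OF P] refl[OF P] h p(2)[OF i]]) simp_all
    then show "j = p i" by simp
  qed (use p(2)[OF i] in simp)
  have RL: "(Ri j, Le i) \<in> R \<longleftrightarrow> j = p i" if "i \<in> {1..n}" for i j
    using sym[of "Ri j" "Le i"] sym[of "Le i" "Ri j"] LR[OF that, of j] by blast
  have LLi: "(Le i, Le j) \<in> R \<longleftrightarrow> i = j" if "i \<in> {1..n}" for i j
  proof
    have "(Le i, Le i) \<in> R" using refl[of "Le i"] that by simp
    then show "(Le i, Le j) \<in> R" if "i = j" using that by simp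
  qed (rule LL)
  have RR: "(Ri j, Ri j') \<in> R \<longleftrightarrow> j = j'" if j: "j \<in> {1..n}" for j j'
  proof
    assume *: "(Ri j, Ri j') \<in> R"
    obtain i where i: "i \<in> {1..n}" "j = p i" using j surj by blast
    then have "(Le i, Ri j) \<in> R" using p(2)[OF i(1)] by simp
    then have "(Le i, Ri j') \<in> R" using * by (rule trans)
    then show "j = j'" using LR[OF i(1)] i(2) by simp
  qed (use refl[of "Ri j"] j in auto)
  have "(x, y) \<in> R \<longleftrightarrow> (x, y) \<in> inv_image (id_rel n) (map_left p)"
    if "x \<in> points n" "y \<in> points n" for x y
  proof -
    have pinj: "p i = p j \<longleftrightarrow> i = j" if "i \<in> {1..n}" "j \<in> {1..n}" for i j
      using inj_onD[OF inj] that by blast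
    have id: "(x, y) \<in> inv_image (id_rel n) (map_left p)
        \<longleftrightarrow> index (map_left p x) = index (map_left p y)"
      using that map_left_in_points[OF permutes_in_image[OF \<open>p permutes {1..n}\<close>]] by (simp add: id_rel_def)
    from that(1) show ?thesis
    proof (cases rule: points_cases)
      case x: (Le i)
      from that(2) show ?thesis
      proof (cases rule: points_cases)
        case (Le j)
        then show ?thesis unfolding id using x LLi[OF x(2), of j] pinj[OF x(2) Le(2)] by simp
      next
        case (Ri j)
        then show ?thesis unfolding id using x LR[OF x(2), of j] by auto
      qed
    next
      case x: (Ri i)
      from that(2) show ?thesis
      proof (cases rule: points_cases)
        case (Le j)
        then show ?thesis unfolding id using x RL[OF Le(2), of i] by simp
      next
        case (Ri j)
        then show ?thesis unfolding id using x RR[OF x(2), of j] by simp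
      qed
    qed
  qed
  moreover have "inv_image (id_rel n) (map_left p) \<subseteq> points n \<times> points n"
    using equiv_type[OF equiv_map_left[OF equiv_id_rel permutes_in_image[OF \<open>p permutes {1..n}\<close>]]] .
  ultimately have "R = inv_image (id_rel n) (map_left p)"
    using equiv_type[OF R(1)] by blast
  then show ?thesis
    using reachable_map_left[OF reachable_id_rel \<open>p permutes {1..n}\<close>] by simp
qed

text \<open>By counting: without right brackets all right points lie on lines, whose left ends
  exhaust the left points, including \<open>a\<close>, which already belongs to a bracket.\<close>

lemma ex_right_bracket:
  assumes R: "equiv (points n) R" "\<And>x. x \<in> points n \<Longrightarrow> card (R `` {x}) = 2"
    and a: "(Le a, Le b) \<in> R" "a \<noteq> b"
  shows "\<exists>c d. c \<noteq> d \<and> (Ri c, Ri d) \<in> R"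
proof (rule ccontr)
  assume no: "\<nexists>c d. c \<noteq> d \<and> (Ri c, Ri d) \<in> R"
  have refl: "(x, x) \<in> R" if "x \<in> points n" for x
    using that R(1) unfolding equiv_iff_refl_sym_trans by blast
  have sym: "(y, x) \<in> R" if "(x, y) \<in> R" for x y
    using that R(1) unfolding equiv_iff_refl_sym_trans by blast
  have trans: "(x, z) \<in> R" if "(x, y) \<in> R" "(y, z) \<in> R" for x y z
    using that R(1) unfolding equiv_iff_refl_sym_trans by blast
  have in_points: "x \<in> points n" "y \<in> points n" if "(x, y) \<in> R" for x y
    using that equiv_type[OF R(1)] by blast+
  have "\<exists>i. i \<in> {1..n} \<and> (Ri j, Le i) \<in> R" if "j \<in> {1..n}" for j
  proof -
    have x: "Ri j \<in> points n" using that by simp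
    obtain y where y: "(Ri j, y) \<in> R" "y \<noteq> Ri j"
      by (rule class_partner[OF R(2)[OF x] refl[OF x]])
    from y(1) have "y \<in> points n" by (rule in_points(2))
    then show ?thesis
    proof (cases rule: points_cases)
      case (Le i)
      then show ?thesis using y(1) by blast
    next
      case (Ri k)
      then have "(Ri j, Ri k) \<in> R" "j \<noteq> k" using y by auto
      with no show ?thesis by blast
    qed
  qed
  then obtain q where q: "\<And>j. j \<in> {1..n} \<Longrightarrow> q j \<in> {1..n} \<and> (Ri j, Le (q j)) \<in> R"
    by metis
  have "inj_on q {1..n}"
  proof (rule inj_onI)
    fix i j assume ij: "i \<in> {1..n}" "j \<in> {1..n}" "q i = q j"
    have "(Ri i, Le (q j)) \<in> R" using q[OF ij(1)] ij(3) by simp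
    moreover have "(Le (q j), Ri j) \<in> R" using q[OF ij(2)] sym by blast
    ultimately have "(Ri i, Ri j) \<in> R" by (rule trans)
    then show "i = j" using no by blast
  qed
  then have "q ` {1..n} = {1..n}"
    using q by (intro endo_inj_surj) auto
  moreover have a_in: "Le a \<in> points n" using in_points a by blast
  ultimately have "a \<in> q ` {1..n}" by simp
  then obtain j where "j \<in> {1..n}" "a = q j" by blast
  then have "(Le a, Ri j) \<in> R" using q sym by blast
  then show False
    using class_unique[OF R(2)[OF a_in] refl[OF a_in] a(1), of "Ri j"] a(2) by auto
qed

lemma inv_image_transpose_Image:
  "inv_image R (transpose u v) `` {x} = transpose u v ` (R `` {transpose u v x})"
proof (intro equalityI subsetI)
  fix y assume "y \<in> inv_image R (transpose u v) `` {x}"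
  then have "transpose u v y \<in> R `` {transpose u v x}" by simp
  then have "transpose u v (transpose u v y) \<in> transpose u v ` (R `` {transpose u v x})"
    by (rule imageI)
  then show "y \<in> transpose u v ` (R `` {transpose u v x})" by simp
qed auto

text \<open>A left bracket \<open>{a, b}\<close> and a right bracket \<open>{c, d}\<close> of \<open>R\<close> are replaced by two lines; the
  original diagram is recovered by multiplying with a bracket on the left.\<close>

lemma reachable_all:
  assumes "equiv (points n) R" "\<And>x. x \<in> points n \<Longrightarrow> card (R `` {x}) = 2"
  shows "reachable n R"
  using assms
proof (induction "card (left_ends R)" arbitrary: R rule: less_induct)
  case less
  note R = less.prems
  have refl: "(x, x) \<in> R" if "x \<in> points n" for x
    using that R(1) unfolding equiv_iff_refl_sym_trans by blast
  have sym: "(y, x) \<in> R" if "(x, y) \<in> R" for x y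
    using that R(1) unfolding equiv_iff_refl_sym_trans by blast
  have in_points: "x \<in> points n" "y \<in> points n" if "(x, y) \<in> R" for x y
    using that equiv_type[OF R(1)] by blast+
  have unique: "y = z" if "(x, y) \<in> R" "(x, z) \<in> R" "y \<noteq> x" "z \<noteq> x" for x y z
    using class_unique[OF R(2) refl that] in_points(1)[OF that(1)] by blast
  show ?case
  proof (cases "left_ends R = {}")
    case True
    then show ?thesis using reachable_no_left_ends[OF R(1)] R(2) by blast
  next
    case False
    then obtain a b where ab: "(Le a, Le b) \<in> R" "a \<noteq> b" unfolding left_ends_def by blast
    obtain c d where cd: "(Ri c, Ri d) \<in> R" "c \<noteq> d"
      using ex_right_bracket[OF R ab] by blast
    have P: "Le a \<in> points n" "Le b \<in> points n" "Ri c \<in> points n" "Ri d \<in> points n"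
      using ab cd in_points by blast+
    \<comment> \<open>Exchanging these two points turns the brackets \<open>{Le a, Le b}\<close> and
      \<open>{Ri c, Ri d}\<close> into the lines \<open>{Le a, Ri c}\<close> and
      \<open>{Le b, Ri d}\<close>.\<close>
    let ?f = "transpose (Le b) (Ri c)"
    let ?R = "inv_image R ?f"
    have f: "?f x \<in> points n \<longleftrightarrow> x \<in> points n" for x
      using P by (auto simp: transpose_def)
    have eq: "equiv (points n) ?R" using R(1) f by (rule equiv_inv_image)
    have card: "card (?R `` {x}) = 2" if "x \<in> points n" for x
      unfolding inv_image_transpose_Image using R(2)[of "?f x"] f that by (simp add: card_image)
    have fin: "finite (left_ends R)"
    proof (rule finite_subset)
      show "left_ends R \<subseteq> {1..n}" using in_points(1) unfolding left_ends_def by fastforce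
    qed simp
    have sub: "i \<in> left_ends R \<and> i \<noteq> a" if i: "i \<in> left_ends ?R" for i
    proof -
      obtain j where j: "j \<noteq> i" "(?f (Le i), ?f (Le j)) \<in> R"
        using i unfolding left_ends_def in_inv_image by blast
      have bj: "?f (Le j) = Le j" if "j \<noteq> b" for j using that by (simp add: transpose_def)
      \<comment> \<open>After the exchange \<open>Le b\<close> has the former partner
        \<open>Ri d\<close> of \<open>Ri c\<close>, so it is no end of a left bracket.\<close>
      have "i \<noteq> b"
      proof
        assume "i = b"
        then have "(Ri c, Le j) \<in> R" using j bj[of j] by simp
        then show False using unique[OF cd(1)] cd(2) by blast
      qed
      moreover have "j \<noteq> b"
      proof
        assume "j = b"
        then have "(Le i, Ri c) \<in> R" using j bj[of i] by simp
        then show False using unique[OF cd(1) sym] cd(2) by blast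
      qed
      ultimately have ij: "(Le i, Le j) \<in> R" using j bj by simp
      have "i \<noteq> a"
      proof
        assume "i = a"
        then have "Le j = Le b" using unique[of "Le a" "Le j" "Le b"] ij ab j(1) by auto
        then show False using \<open>j \<noteq> b\<close> by simp
      qed
      then show ?thesis using ij j(1) unfolding left_ends_def by blast
    qed
    have "a \<in> left_ends R" using ab unfolding left_ends_def by auto
    then have "left_ends ?R \<subset> left_ends R" using sub by blast
    then have "card (left_ends ?R) < card (left_ends R)" by (rule psubset_card_mono[OF fin])
    then have "reachable n ?R" using eq card by (rule less.hyps)
    then have "reachable n (cup_cap (Le b) (Le a) ?R)"
      using P ab(2) by (intro reachable_cup_cap) auto
    also have "cup_cap (Le b) (Le a) ?R = R"
    proof -
      have dist: "distinct [Le b, Le a, Ri c]" "{Le b, Le a, Ri c} \<subseteq> points n"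
        using P ab(2) by auto
      have "(Le b, y) \<in> R \<longleftrightarrow> y \<in> {Le b, Le a}" for y
      proof
        assume "(Le b, y) \<in> R"
        from unique[OF this sym[OF ab(1)]] show "y \<in> {Le b, Le a}" using ab(2) by auto
      qed (use sym[OF ab(1)] refl[OF P(2)] in auto)
      then have "R `` {Le b} = {Le b, Le a}" by blast
      then have absorb: "cup_cap (Le b) (Le a) R = R"
        by (rule cup_cap_absorb[OF R(1)])
      \<comment> \<open>Read backwards, \<open>cup_cap_cup_cap\<close> replaces the exchange by a
        surgery at a left and a right point. As \<open>R\<close> contains the bracket
        \<open>{Le b, Le a}\<close>, this surgery is enclosed between two equal ones and disappears
        by \<open>cup_cap_triple\<close>.\<close>
      have "cup_cap (Le b) (Le a) ?R = cup_cap (Le b) (Le a) (cup_cap (Le a) (Ri c) R)"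
        by (rule cup_cap_cup_cap[OF R(1) dist, symmetric])
      also have "\<dots> = cup_cap (Le b) (Le a) (cup_cap (Le a) (Ri c) (cup_cap (Le b) (Le a) R))"
        by (simp only: absorb)
      also have "\<dots> = R"
        unfolding cup_cap_triple[OF R(1) dist] by (rule absorb)
      finally show ?thesis .
    qed
    finally show ?thesis .
  qed
qed

section \<open>The isomorphism\<close>

lemma T_rels_lists:
  assumes "(u, v) \<in> T_rels n"
  shows "u \<in> lists (gens n)" "v \<in> lists (gens n)"
  using assms by (cases; simp add: gens_def)+

lemma T_class_eqI: "(u, v) \<in> pres_cong (gens n) (T_rels n) \<Longrightarrow> T_class n u = T_class n v"
  unfolding T_class_def pres_class_def by (rule equiv_class_eq[OF equiv_pres_cong])

lemma T_class_eqD: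
  assumes "T_class n u = T_class n v" "u \<in> lists (gens n)" "v \<in> lists (gens n)"
  shows "(u, v) \<in> pres_cong (gens n) (T_rels n)"
  using assms unfolding T_class_def pres_class_def
  by (simp only: eq_equiv_class_iff[OF equiv_pres_cong])

lemma carrier_T_monoid: "carrier (T_monoid n) = T_class n ` lists (gens n)"
  unfolding T_monoid_def presented_monoid_def T_class_def pres_class_def quotient_def
    monoid.simps partial_object.simps by blast

text \<open>Left multiplication on classes, extended by the identity to all other sets so that the
  defining relations hold on the whole type.\<close>

definition class_act :: "nat \<Rightarrow> gen \<Rightarrow> gen list set \<Rightarrow> gen list set" where
  "class_act n g A = (if A \<in> carrier (T_monoid n)
     then T_class n (g # (SOME w. w \<in> lists (gens n) \<and> A = T_class n w)) else A)"

lemma class_act_T_class: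
  assumes "g \<in> gens n" "w \<in> lists (gens n)"
  shows "class_act n g (T_class n w) = T_class n (g # w)"
proof -
  let ?v = "SOME v. v \<in> lists (gens n) \<and> T_class n w = T_class n v"
  have v: "?v \<in> lists (gens n) \<and> T_class n w = T_class n ?v"
    by (rule someI[of _ w]) (use assms(2) in blast)
  then have "([g] @ w, [g] @ ?v) \<in> pres_cong (gens n) (T_rels n)"
    using assms by (intro pres_cong.append pres_cong.refl T_class_eqD) auto
  then have "T_class n (g # w) = T_class n (g # ?v)"
    using T_class_eqI by fastforce
  then show ?thesis
    unfolding class_act_def carrier_T_monoid using assms(2) by simp
qed

lemma foldr_class_act:
  assumes "u \<in> lists (gens n)" "w \<in> lists (gens n)"
  shows "foldr (class_act n) u (T_class n w) = T_class n (u @ w)"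
  using assms(1)
proof induction
  case (Cons g u)
  have "u @ w \<in> lists (gens n)" using Cons.hyps assms(2) by auto
  then show ?case using Cons class_act_T_class by simp
qed simp

interpretation class_act: brauer_action n "class_act n" for n
proof
  fix u v :: "gen list" and A :: "gen list set"
  assume uv: "(u, v) \<in> T_rels n"
  note L = T_rels_lists[OF uv]
  show "foldr (class_act n) u A = foldr (class_act n) v A"
  proof (cases "A \<in> carrier (T_monoid n)")
    case True
    then obtain w where w: "w \<in> lists (gens n)" "A = T_class n w"
      unfolding carrier_T_monoid by blast
    have "(u @ w, v @ w) \<in> pres_cong (gens n) (T_rels n)"
      using uv L w by (intro pres_cong.append pres_cong.rel pres_cong.refl)
    then show ?thesis unfolding w(2) using foldr_class_act L w(1) T_class_eqI by metis
  next
    case False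
    have "foldr (class_act n) x A = A" for x
      using False by (induction x) (simp_all add: class_act_def)
    then show ?thesis by simp
  qed
qed

text \<open>From left to right, equality of operators is evaluated at the class of the empty word,
  where each word returns its own class.\<close>

lemma word_rel_eq_iff:
  assumes "u \<in> lists (gens n)" "v \<in> lists (gens n)"
  shows "word_rel n u = word_rel n v \<longleftrightarrow> T_class n u = T_class n v"
proof
  assume "word_rel n u = word_rel n v"
  then have "foldr (class_act n) u (T_class n []) = foldr (class_act n) v (T_class n [])"
    by (rule class_act.foldr_act_eq_if_word_rel_eq[OF assms])
  then show "T_class n u = T_class n v"
    using foldr_class_act[OF assms(1), of "[]"] foldr_class_act[OF assms(2), of "[]"] by simp
qed (use word_rel_cong T_class_eqD assms in blast)

section \<open>The map from words to diagrams\<close>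

definition diagram :: "nat \<Rightarrow> gen list \<Rightarrow> point set set" where
  "diagram n w = points n // word_rel n w"

lemma diagram_eq_iff:
  assumes "u \<in> lists (gens n)" "v \<in> lists (gens n)"
  shows "diagram n u = diagram n v \<longleftrightarrow> T_class n u = T_class n v"
  unfolding word_rel_eq_iff[OF assms, symmetric] diagram_def
  using block_rel_quotient[OF equiv_word_rel[OF assms(1)]]
    block_rel_quotient[OF equiv_word_rel[OF assms(2)]] by metis

lemma diagram_append:
  assumes "u \<in> lists (gens n)" "v \<in> lists (gens n)"
  shows "diagram n (u @ v) = partition_mult n (diagram n u) (diagram n v)"
  unfolding diagram_def word_rel_append[OF assms]
  by (rule partition_mult_quotient[OF equiv_word_rel[OF assms(1)] equiv_word_rel[OF assms(2)], symmetric])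

lemma carrier_brauer_monoid:
  "carrier (brauer_monoid n) = {\<alpha>. partition_on (points n) \<alpha> \<and> (\<forall>B\<in>\<alpha>. card B = 2)}"
  by (simp add: brauer_monoid_def partition_monoid_def)

lemma diagram_image: "diagram n ` lists (gens n) = carrier (brauer_monoid n)"
proof (intro equalityI subsetI)
  fix \<alpha> assume "\<alpha> \<in> diagram n ` lists (gens n)"
  then obtain w where w: "w \<in> lists (gens n)" "\<alpha> = points n // word_rel n w"
    unfolding diagram_def by blast
  \<comment> \<open>The size of the blocks is read off from the diagram half of the normal
    form.\<close>
  obtain P p where "matching n P" "p permutes {1..n}" "word_rel n w = diagram_rel n P p"
    using class_act.normal_form[OF w(1)] by blast
  then have "card B = 2" if "B \<in> \<alpha>" for B
    using that card_diagram_rel_class unfolding w(2) by (metis quotientE)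
  then show "\<alpha> \<in> carrier (brauer_monoid n)"
    unfolding carrier_brauer_monoid w(2)
    using partition_on_quotient[OF equiv_word_rel[OF w(1)]] by blast
next
  fix \<alpha> assume "\<alpha> \<in> carrier (brauer_monoid n)"
  then have \<alpha>: "partition_on (points n) \<alpha>" "\<And>B. B \<in> \<alpha> \<Longrightarrow> card B = 2"
    unfolding carrier_brauer_monoid by blast+
  have eq: "equiv (points n) (block_rel \<alpha>)"
    unfolding block_rel_def by (rule equiv_partition_on[OF \<alpha>(1)])
  have quot: "points n // block_rel \<alpha> = \<alpha>"
    unfolding block_rel_def by (rule partition_on_eq_quotient[OF \<alpha>(1)])
  have "card (block_rel \<alpha> `` {x}) = 2" if "x \<in> points n" for x
    using quotientI[OF that, of "block_rel \<alpha>"] \<alpha>(2) unfolding quot by blast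
  from reachable_all[OF eq this] obtain w where "w \<in> lists (gens n)" "word_rel n w = block_rel \<alpha>"
    unfolding reachable_def by blast
  moreover from this have "\<alpha> = diagram n w" unfolding diagram_def using quot by simp
  ultimately show "\<alpha> \<in> diagram n ` lists (gens n)" by blast
qed

section \<open>Diagrams of the identity and the generators\<close>

lemma quotient_Le_Ri:
  "points n // R = (\<lambda>j. R `` {Le j}) ` {1..n} \<union> (\<lambda>j. R `` {Ri j}) ` {1..n}"
  unfolding quotient_def points_def by blast

lemma diagram_Nil: "diagram n [] = \<one>\<^bsub>brauer_monoid n\<^esub>"
proof -
  have "id_rel n `` {Le j} = {Le j, Ri j}" "id_rel n `` {Ri j} = {Le j, Ri j}" if "j \<in> {1..n}" for j
    using that unfolding id_rel_def by (auto elim!: points_cases)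
  then have "points n // id_rel n = (\<lambda>j. {Le j, Ri j}) ` {1..n}"
    unfolding quotient_Le_Ri by (simp del: atLeastAtMost_iff)
  then show ?thesis
    by (auto simp: diagram_def brauer_monoid_def partition_monoid_def)
qed

lemma diagram_s:
  assumes "i \<in> {1..n - 1}"
  shows "diagram n [\<sigma> i] = brauer_s n i"
proof -
  let ?t = "transpose i (Suc i)" and ?R = "word_rel n [\<sigma> i]"
  have t: "?t j \<in> {1..n} \<longleftrightarrow> j \<in> {1..n}" for j by (rule transpose_Suc_in[OF assms])
  have mem: "(x, y) \<in> ?R \<longleftrightarrow> x \<in> points n \<and> y \<in> points n \<and> index (map_left ?t x) = index (map_left ?t y)" for x y
    by (simp add: id_rel_def map_left_in_points[OF t])
  have "?R `` {Le j} = {Le j, Ri (?t j)}" if "j \<in> {1..n}" for j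
    using that t[of j] unfolding Image_def mem
    by (auto simp: inj_eq[OF inj_transpose] simp del: atLeastAtMost_iff elim!: points_cases)
  moreover have "?R `` {Ri j} = {Le (?t j), Ri j}" if "j \<in> {1..n}" for j
    using that t[of j] unfolding Image_def mem
    by (auto simp: inj_eq[OF inj_transpose] simp del: atLeastAtMost_iff elim!: points_cases)
  ultimately have "points n // ?R = (\<lambda>j. {Le j, Ri (?t j)}) ` {1..n} \<union> (\<lambda>j. {Le (?t j), Ri j}) ` {1..n}"
    unfolding quotient_Le_Ri by (simp del: atLeastAtMost_iff)
  \<comment> \<open>Reindexing by the involution shows that the classes of right points are the same
    blocks as those of left points.\<close>
  also have "(\<lambda>j. {Le (?t j), Ri j}) ` {1..n} = (\<lambda>j. {Le j, Ri (?t j)}) ` ?t ` {1..n}"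
    by (simp add: image_image)
  also have "?t ` {1..n} = {1..n}"
    using assms by (intro transpose_image_eq) auto
  also have "(\<lambda>j. {Le j, Ri (?t j)}) ` {1..n} \<union> (\<lambda>j. {Le j, Ri (?t j)}) ` {1..n} = brauer_s n i"
  proof -
    have split: "{1..n} = {i, Suc i} \<union> {j \<in> {1..n}. j \<noteq> i \<and> j \<noteq> Suc i}"
      using assms by auto
    have "(\<lambda>j. {Le j, Ri (?t j)}) ` {j \<in> {1..n}. j \<noteq> i \<and> j \<noteq> Suc i}
        = {{Le j, Ri j} | j. j \<in> {1..n} \<and> j \<noteq> i \<and> j \<noteq> i + 1}"
      by auto
    then show ?thesis
      unfolding brauer_s_def by (subst (1 2) split) (simp add: image_Un)
  qed
  finally show ?thesis unfolding diagram_def .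
qed

lemma diagram_pi:
  assumes "i \<in> {1..n - 1}"
  shows "diagram n [\<theta> i] = brauer_pi n i"
proof -
  let ?R = "word_rel n [\<theta> i]" and ?J = "{j \<in> {1..n}. j \<noteq> i \<and> j \<noteq> Suc i}"
  have i: "i \<in> {1..n}" "Suc i \<in> {1..n}" using assms by auto
  have R: "equiv (points n) ?R"
    using assms by (intro equiv_word_rel) (simp add: gens_def)
  have mem: "z \<in> ?R `` {x} \<longleftrightarrow> z \<in> points n \<and> (x, z) \<in> cup_cap (Le i) (Le (Suc i)) (id_rel n)" for x z
    using equiv_type[OF R] by auto
  have L: "?R `` {Le j} = {Le i, Le (Suc i)}" if "j \<in> {i, Suc i}" for j
    using that i by (auto simp: cup_cap_def)
  have Rb: "?R `` {Ri j} = {Ri i, Ri (Suc i)}" if "j \<in> {i, Suc i}" for j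
  proof (rule Set.set_eqI)
    fix z show "z \<in> ?R `` {Ri j} \<longleftrightarrow> z \<in> {Ri i, Ri (Suc i)}"
      unfolding mem using that i by (cases z) (auto simp: cup_cap_def id_rel_def)
  qed
  have LJ: "?R `` {Le j} = {Le j, Ri j}" if "j \<in> ?J" for j
  proof (rule Set.set_eqI)
    fix z show "z \<in> ?R `` {Le j} \<longleftrightarrow> z \<in> {Le j, Ri j}"
      unfolding mem using that i by (cases z) (auto simp: cup_cap_def id_rel_def)
  qed
  have RJ: "?R `` {Ri j} = {Le j, Ri j}" if "j \<in> ?J" for j
  proof (rule Set.set_eqI)
    fix z show "z \<in> ?R `` {Ri j} \<longleftrightarrow> z \<in> {Le j, Ri j}"
      unfolding mem using that i by (cases z) (auto simp: cup_cap_def id_rel_def)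
  qed
  have split: "f ` {1..n} = {f i, f (Suc i)} \<union> f ` ?J" for f :: "nat \<Rightarrow> point set"
    using i by auto
  have "(\<lambda>j. ?R `` {Le j}) ` {1..n} = {{Le i, Le (Suc i)}} \<union> (\<lambda>j. {Le j, Ri j}) ` ?J"
  proof -
    have "(\<lambda>j. ?R `` {Le j}) ` ?J = (\<lambda>j. {Le j, Ri j}) ` ?J"
      by (rule image_cong[OF HOL.refl LJ])
    then show ?thesis unfolding split[of "\<lambda>j. ?R `` {Le j}"] using L by simp
  qed
  moreover have "(\<lambda>j. ?R `` {Ri j}) ` {1..n} = {{Ri i, Ri (Suc i)}} \<union> (\<lambda>j. {Le j, Ri j}) ` ?J"
  proof -
    have "(\<lambda>j. ?R `` {Ri j}) ` ?J = (\<lambda>j. {Le j, Ri j}) ` ?J"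
      by (rule image_cong[OF HOL.refl RJ])
    then show ?thesis unfolding split[of "\<lambda>j. ?R `` {Ri j}"] using Rb by simp
  qed
  moreover have "(\<lambda>j. {Le j, Ri j}) ` ?J = {{Le j, Ri j} | j. j \<in> {1..n} \<and> j \<noteq> i \<and> j \<noteq> i + 1}"
    by auto
  ultimately show ?thesis
    unfolding diagram_def quotient_Le_Ri brauer_pi_def by auto
qed

theorem theorem3:
  fixes n :: nat
  shows "\<exists>\<phi> \<in> iso (T_monoid n) (brauer_monoid n).
    \<phi> \<one>\<^bsub>T_monoid n\<^esub> = \<one>\<^bsub>brauer_monoid n\<^esub> \<and>
    (\<forall>i\<in>{1..n - 1}. \<phi> (T_class n [\<sigma> i]) = brauer_s n i \<and>
                   \<phi> (T_class n [\<theta> i]) = brauer_pi n i)"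
proof -
  \<comment> \<open>The diagram of an arbitrary representative; \<open>diagram_eq_iff\<close> makes
    the choice immaterial in one direction and gives injectivity in the other.\<close>
  define \<phi> where "\<phi> A = diagram n (SOME w. w \<in> lists (gens n) \<and> A = T_class n w)" for A
  have \<phi>: "\<phi> (T_class n w) = diagram n w" if w: "w \<in> lists (gens n)" for w
  proof -
    let ?v = "SOME v. v \<in> lists (gens n) \<and> T_class n w = T_class n v"
    have "?v \<in> lists (gens n) \<and> T_class n w = T_class n ?v"
      by (rule someI[of _ w]) (use w in blast)
    then show ?thesis unfolding \<phi>_def using diagram_eq_iff[OF w] by metis
  qed
  have mult: "T_class n u \<otimes>\<^bsub>T_monoid n\<^esub> T_class n v = T_class n (u @ v)"
    if "u \<in> lists (gens n)" "v \<in> lists (gens n)" for u v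
    unfolding T_monoid_def T_class_def by (rule presented_monoid_mult_class[OF that])
  have "\<phi> \<in> hom (T_monoid n) (brauer_monoid n)"
  proof (rule homI)
    fix A assume "A \<in> carrier (T_monoid n)"
    then show "\<phi> A \<in> carrier (brauer_monoid n)"
      unfolding carrier_T_monoid diagram_image[symmetric] using \<phi> by auto
  next
    fix A B assume "A \<in> carrier (T_monoid n)" "B \<in> carrier (T_monoid n)"
    then obtain u v where uv: "u \<in> lists (gens n)" "v \<in> lists (gens n)" "A = T_class n u" "B = T_class n v"
      unfolding carrier_T_monoid by blast
    then have "u @ v \<in> lists (gens n)" by auto
    then show "\<phi> (A \<otimes>\<^bsub>T_monoid n\<^esub> B) = \<phi> A \<otimes>\<^bsub>brauer_monoid n\<^esub> \<phi> B"
      unfolding uv(3,4) mult[OF uv(1,2)] using uv(1,2) \<phi> diagram_append[OF uv(1,2)]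
      by (simp add: brauer_monoid_def partition_monoid_def)
  qed
  moreover have "bij_betw \<phi> (carrier (T_monoid n)) (carrier (brauer_monoid n))"
    unfolding bij_betw_def
  proof
    show "inj_on \<phi> (carrier (T_monoid n))"
      unfolding carrier_T_monoid
    proof (rule inj_onI)
      fix A B assume "A \<in> T_class n ` lists (gens n)" "B \<in> T_class n ` lists (gens n)" "\<phi> A = \<phi> B"
      then show "A = B" using \<phi> diagram_eq_iff by (metis imageE)
    qed
    show "\<phi> ` carrier (T_monoid n) = carrier (brauer_monoid n)"
      unfolding carrier_T_monoid diagram_image[symmetric] image_image
      by (rule image_cong[OF HOL.refl \<phi>])
  qed
  ultimately have "\<phi> \<in> iso (T_monoid n) (brauer_monoid n)"
    unfolding iso_def by blast
  moreover have "\<one>\<^bsub>T_monoid n\<^esub> = T_class n []"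
    by (simp add: T_monoid_def presented_monoid_def T_class_def)
  then have "\<phi> \<one>\<^bsub>T_monoid n\<^esub> = \<one>\<^bsub>brauer_monoid n\<^esub>"
    using \<phi>[of "[]"] diagram_Nil by simp
  moreover have "\<phi> (T_class n [\<sigma> i]) = brauer_s n i" "\<phi> (T_class n [\<theta> i]) = brauer_pi n i"
    if "i \<in> {1..n - 1}" for i
    using that \<phi>[of "[\<sigma> i]"] \<phi>[of "[\<theta> i]"] diagram_s diagram_pi by (simp_all add: gens_def)
  ultimately show ?thesis by blast
qed

end
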